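(* Suppose $(G,X,H)$ is an A/QI triple, where $X$ is a Gromov hyperbolic graph on which $G$ acts by graph automorphisms. Fix a vertex $x\in X$, let $\mathcal H=\{gHx\mid gH\in G/H\}$, and let $\hat X$ be the cone-off of $X$ with respect to $\mathcal H$. (1) If $g\in G$ acts loxodromically on $X$, then either $g$ acts loxodromically on $\hat X$, or a (nonzero) power of $g$ stabilizes some $Y\in\mathcal H$, and so $g$ acts elliptically on $\hat X$. (2) An element $g\in G$ acts parabolically on $X$ if and only if it acts parabolically on $\hat X$.
   Context: Graphs are connected and metrized with all edges of length 1. A hyperbolic space is a Gromov hyperbolic geodesic metric space $(X,d)$; all actions are by isometries. For $Y\subseteq X$, an action $G\curvearrowright X$ is acylindrical along $Y$ if for every $\varepsilon\ge 0$ there are $R>0$ and $M>0$ so that, whenever $x,y\in Y$ satisfy $d(x,y)\ge R$, $\#\{g\in G\mid d(gx,x)\le\varepsilon \text{ and } d(gy,y)\le\varepsilon\}\le M$. For $H<G$, the action is acylindrical along $H$ if it is acylindrical along $Hx$ for some (equivalently any) $x\in X$. A finitely generated subgroup $H<G$ is quasi-isometrically embedded by the action if, for some (equivalently any) $x\in X$, $h\mapsto hx$ is a quasi-isometric embedding of $H$ (with a word metric) into $X$. An A/QI triple $(G,X,H)$ consists of a hyperbolic space $X$ and an action $G\curvearrowright X$ which is acylindrical along a finitely generated infinite subgroup $H<G$ that is quasi-isometrically embedded by the action. Cone-off: the cone-off $\hat X$ of $X$ with respect to a collection $\mathcal H$ is the graph obtained from $X$ by adding an edge (of length 1) between each pair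 of distinct vertices that both lie in a common element of $\mathcal H$. In the present situation $\hat X$ is known to be Gromov hyperbolic, and $G$ acts on it by isometries. For an isometric action of $G$ on a Gromov hyperbolic space $Z$ with base point $z_0$, an element $g$ is elliptic if some (equivalently any) orbit of $\langle g\rangle$ is bounded, loxodromic if $n\mapsto g^nz_0$ is a quasi-isometric embedding $\mathbb Z\to Z$, and parabolic if it is neither elliptic nor loxodromic. *)

theory Defs
  imports "HOL-Analysis.Abstract_Metric_Spaces" "HOL-Algebra.Group_Action"
    "HOL-Algebra.Generated_Groups" "Graph_Theory.Graph_Theory"
begin

section \<open>Hyperbolic spaces and isometric actions\<close>

definition geodesic_space :: "'a set \<Rightarrow> ('a \<Rightarrow> 'a \<Rightarrow> real) \<Rightarrow> bool" where
  "geodesic_space M d \<longleftrightarrow> Metric_space M d \<and>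
     (\<forall>x\<in>M. \<forall>y\<in>M. \<exists>c :: real \<Rightarrow> 'a. c 0 = x \<and> c (d x y) = y \<and> c ` {0..d x y} \<subseteq> M \<and>
        (\<forall>s\<in>{0..d x y}. \<forall>t\<in>{0..d x y}. d (c s) (c t) = \<bar>s - t\<bar>))"

text \<open>Gromov's four-point condition, with constant \<open>\<delta>\<close> in terms of Gromov products.\<close>

definition gromov_hyperbolic :: "'a set \<Rightarrow> ('a \<Rightarrow> 'a \<Rightarrow> real) \<Rightarrow> bool" where
  "gromov_hyperbolic M d \<longleftrightarrow>
     (\<exists>\<delta>\<ge>0. \<forall>x\<in>M. \<forall>y\<in>M. \<forall>z\<in>M. \<forall>w\<in>M.
        d x y + d z w \<le> max (d x z + d y w) (d x w + d y z) + 2 * \<delta>)"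

definition hyperbolic_space :: "'a set \<Rightarrow> ('a \<Rightarrow> 'a \<Rightarrow> real) \<Rightarrow> bool" where
  "hyperbolic_space M d \<longleftrightarrow> geodesic_space M d \<and> gromov_hyperbolic M d"

definition isometric_action ::
    "('g, 'm) monoid_scheme \<Rightarrow> 'a set \<Rightarrow> ('a \<Rightarrow> 'a \<Rightarrow> real) \<Rightarrow> ('g \<Rightarrow> 'a \<Rightarrow> 'a) \<Rightarrow> bool" where
  "isometric_action G M d \<phi> \<longleftrightarrow> group_action G M \<phi> \<and>
     (\<forall>g\<in>carrier G. \<forall>x\<in>M. \<forall>y\<in>M. d (\<phi> g x) (\<phi> g y) = d x y)"

definition qi_embedding ::
    "'a set \<Rightarrow> ('a \<Rightarrow> 'a \<Rightarrow> real) \<Rightarrow> 'b set \<Rightarrow> ('b \<Rightarrow> 'b \<Rightarrow> real) \<Rightarrow> ('a \<Rightarrow> 'b) \<Rightarrow> bool" where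
  "qi_embedding A dA B dB f \<longleftrightarrow> f ` A \<subseteq> B \<and>
     (\<exists>L\<ge>1. \<exists>C\<ge>0. \<forall>a\<in>A. \<forall>b\<in>A.
        dA a b / L - C \<le> dB (f a) (f b) \<and> dB (f a) (f b) \<le> L * dA a b + C)"

section \<open>A/QI triples\<close>

definition acylindrical_along ::
    "('g, 'm) monoid_scheme \<Rightarrow> ('a \<Rightarrow> 'a \<Rightarrow> real) \<Rightarrow> ('g \<Rightarrow> 'a \<Rightarrow> 'a) \<Rightarrow> 'a set \<Rightarrow> bool" where
  "acylindrical_along G d \<phi> Y \<longleftrightarrow>
     (\<forall>\<epsilon>\<ge>0. \<exists>R>0. \<exists>N::nat. N > 0 \<and> (\<forall>x\<in>Y. \<forall>y\<in>Y. d x y \<ge> R \<longrightarrow>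
        finite {g \<in> carrier G. d (\<phi> g x) x \<le> \<epsilon> \<and> d (\<phi> g y) y \<le> \<epsilon>} \<and>
        card {g \<in> carrier G. d (\<phi> g x) x \<le> \<epsilon> \<and> d (\<phi> g y) y \<le> \<epsilon>} \<le> N))"

definition acylindrical_along_subgroup ::
    "('g, 'm) monoid_scheme \<Rightarrow> 'a set \<Rightarrow> ('a \<Rightarrow> 'a \<Rightarrow> real) \<Rightarrow> ('g \<Rightarrow> 'a \<Rightarrow> 'a) \<Rightarrow> 'g set \<Rightarrow> bool" where
  "acylindrical_along_subgroup G M d \<phi> H \<longleftrightarrow>
     (\<exists>x\<in>M. acylindrical_along G d \<phi> ((\<lambda>h. \<phi> h x) ` H))"

definition finite_generating_set :: "('g, 'm) monoid_scheme \<Rightarrow> 'g set \<Rightarrow> 'g set \<Rightarrow> bool" where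
  "finite_generating_set G H S \<longleftrightarrow> finite S \<and> S \<subseteq> H \<and> generate G S = H"

definition word_length :: "('g, 'm) monoid_scheme \<Rightarrow> 'g set \<Rightarrow> 'g \<Rightarrow> nat" where
  "word_length G S h = (LEAST n. \<exists>ws. length ws = n \<and>
     set ws \<subseteq> S \<union> (\<lambda>s. inv\<^bsub>G\<^esub> s) ` S \<and> foldr (\<otimes>\<^bsub>G\<^esub>) ws \<one>\<^bsub>G\<^esub> = h)"

definition word_dist :: "('g, 'm) monoid_scheme \<Rightarrow> 'g set \<Rightarrow> 'g \<Rightarrow> 'g \<Rightarrow> real" where
  "word_dist G S a b = real (word_length G S (inv\<^bsub>G\<^esub> a \<otimes>\<^bsub>G\<^esub> b))"

definition qi_embedded_by_action ::
    "('g, 'm) monoid_scheme \<Rightarrow> 'a set \<Rightarrow> ('a \<Rightarrow> 'a \<Rightarrow> real) \<Rightarrow> ('g \<Rightarrow> 'a \<Rightarrow> 'a) \<Rightarrow> 'g set \<Rightarrow> bool" where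
  "qi_embedded_by_action G M d \<phi> H \<longleftrightarrow>
     (\<exists>S. finite_generating_set G H S \<and>
        (\<exists>x\<in>M. qi_embedding H (word_dist G S) M d (\<lambda>h. \<phi> h x)))"

definition AQI_triple ::
    "('g, 'm) monoid_scheme \<Rightarrow> 'a set \<Rightarrow> ('a \<Rightarrow> 'a \<Rightarrow> real) \<Rightarrow> ('g \<Rightarrow> 'a \<Rightarrow> 'a) \<Rightarrow> 'g set \<Rightarrow> bool" where
  "AQI_triple G M d \<phi> H \<longleftrightarrow>
     hyperbolic_space M d \<and> isometric_action G M d \<phi> \<and>
     subgroup H G \<and> (\<exists>S. finite_generating_set G H S) \<and> infinite H \<and>
     acylindrical_along_subgroup G M d \<phi> H \<and> qi_embedded_by_action G M d \<phi> H"

section \<open>Elliptic, loxodromic and parabolic elements\<close>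

definition acts_elliptically ::
    "('g, 'm) monoid_scheme \<Rightarrow> 'a set \<Rightarrow> ('a \<Rightarrow> 'a \<Rightarrow> real) \<Rightarrow> ('g \<Rightarrow> 'a \<Rightarrow> 'a) \<Rightarrow> 'g \<Rightarrow> bool" where
  "acts_elliptically G M d \<phi> g \<longleftrightarrow>
     (\<exists>z\<in>M. Metric_space.mbounded M d (range (\<lambda>n::int. \<phi> (g [^]\<^bsub>G\<^esub> n) z)))"

definition acts_loxodromically ::
    "('g, 'm) monoid_scheme \<Rightarrow> 'a set \<Rightarrow> ('a \<Rightarrow> 'a \<Rightarrow> real) \<Rightarrow> ('g \<Rightarrow> 'a \<Rightarrow> 'a) \<Rightarrow> 'g \<Rightarrow> bool" where
  "acts_loxodromically G M d \<phi> g \<longleftrightarrow>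
     (\<exists>z\<in>M. qi_embedding UNIV (\<lambda>m n::int. real_of_int \<bar>m - n\<bar>) M d (\<lambda>n. \<phi> (g [^]\<^bsub>G\<^esub> n) z))"

definition acts_parabolically ::
    "('g, 'm) monoid_scheme \<Rightarrow> 'a set \<Rightarrow> ('a \<Rightarrow> 'a \<Rightarrow> real) \<Rightarrow> ('g \<Rightarrow> 'a \<Rightarrow> 'a) \<Rightarrow> 'g \<Rightarrow> bool" where
  "acts_parabolically G M d \<phi> g \<longleftrightarrow>
     \<not> acts_elliptically G M d \<phi> g \<and> \<not> acts_loxodromically G M d \<phi> g"

section \<open>Metric graphs\<close>

text \<open>
  A graph is a graph in the sense of Serre, possibly infinite, with loops and multiple edges
  allowed: each edge is a pair of opposite arcs \<open>e\<close> and \<open>\<iota> e\<close>.  Since \<open>\<iota>\<close> is part of the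
  structure, strong connectedness is connectedness of the underlying graph.
\<close>

definition connected_graph :: "('v, 'e) pre_digraph \<Rightarrow> ('e \<Rightarrow> 'e) \<Rightarrow> bool" where
  "connected_graph X \<iota> \<longleftrightarrow> bidirected_digraph X \<iota> \<and> strongly_connected X"

definition vertex_dist :: "('v, 'e) pre_digraph \<Rightarrow> 'v \<Rightarrow> 'v \<Rightarrow> nat" where
  "vertex_dist X u v = (LEAST n. \<exists>p. pre_digraph.awalk X u p v \<and> length p = n)"

text \<open>
  The geometric realization.  The point at distance \<open>t\<close> from the tail along the arc \<open>e\<close>, with
  \<open>0 < t < 1\<close>, also lies at distance \<open>1 - t\<close> along \<open>\<iota> e\<close>; it is represented by the set of
  these two descriptions.
\<close>

type_synonym ('v, 'e) graph_point = "'v + ('e \<times> real) set"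

definition realization :: "('v, 'e) pre_digraph \<Rightarrow> ('e \<Rightarrow> 'e) \<Rightarrow> ('v, 'e) graph_point set" where
  "realization X \<iota> = Inl ` verts X \<union>
     {Inr {(e, t), (\<iota> e, 1 - t)} | e t. e \<in> arcs X \<and> 0 < t \<and> t < 1}"

text \<open>The endpoints of the closed edge containing a point, with the distances to them along
  that edge; a vertex is its own unique endpoint.\<close>

fun endpoints :: "('v, 'e) pre_digraph \<Rightarrow> ('v, 'e) graph_point \<Rightarrow> ('v \<times> real) set" where
  "endpoints X (Inl v) = {(v, 0)}"
| "endpoints X (Inr P) = (\<lambda>(e, t). (tail X e, t)) ` P"

fun direct_lengths :: "('v, 'e) graph_point \<Rightarrow> ('v, 'e) graph_point \<Rightarrow> real set" where
  "direct_lengths (Inr P) (Inr Q) = {\<bar>s - t\<bar> | e s t. (e, s) \<in> P \<and> (e, t) \<in> Q}"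
| "direct_lengths _ _ = {}"

text \<open>
  The path metric with all edges of length 1: a shortest path either runs inside one open edge,
  or first leaves and finally enters an edge through endpoints.  Outside the realization the
  value is irrelevant.
\<close>

definition graph_dist ::
    "('v, 'e) pre_digraph \<Rightarrow> ('e \<Rightarrow> 'e) \<Rightarrow> ('v, 'e) graph_point \<Rightarrow> ('v, 'e) graph_point \<Rightarrow> real" where
  "graph_dist X \<iota> p q =
     (if p \<in> realization X \<iota> \<and> q \<in> realization X \<iota>
      then Min (direct_lengths p q \<union>
             {s + real (vertex_dist X u v) + t | u s v t.
                (u, s) \<in> endpoints X p \<and> (v, t) \<in> endpoints X q})
      else 0)"

section \<open>Actions by graph automorphisms\<close>

definition graph_action :: "('g, 'm) monoid_scheme \<Rightarrow> ('v, 'e) pre_digraph \<Rightarrow> ('e \<Rightarrow> 'e) \<Rightarrow>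
    ('g \<Rightarrow> 'v \<Rightarrow> 'v) \<Rightarrow> ('g \<Rightarrow> 'e \<Rightarrow> 'e) \<Rightarrow> bool" where
  "graph_action G X \<iota> \<alpha> \<beta> \<longleftrightarrow> group_action G (verts X) \<alpha> \<and> group_action G (arcs X) \<beta> \<and>
     (\<forall>g\<in>carrier G. \<forall>e\<in>arcs X.
        tail X (\<beta> g e) = \<alpha> g (tail X e) \<and> head X (\<beta> g e) = \<alpha> g (head X e) \<and>
        \<beta> g (\<iota> e) = \<iota> (\<beta> g e))"

text \<open>The induced action on the realization.  The restriction is needed because
  \<^const>\<open>group_action\<close> is about extensional functions.\<close>

definition realization_action :: "('v, 'e) pre_digraph \<Rightarrow> ('e \<Rightarrow> 'e) \<Rightarrow>
    ('g \<Rightarrow> 'v \<Rightarrow> 'v) \<Rightarrow> ('g \<Rightarrow> 'e \<Rightarrow> 'e) \<Rightarrow> 'g \<Rightarrow> ('v, 'e) graph_point \<Rightarrow> ('v, 'e) graph_point" where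
  "realization_action X \<iota> \<alpha> \<beta> g =
     restrict (map_sum (\<alpha> g) (\<lambda>P. (\<lambda>(e, t). (\<beta> g e, t)) ` P)) (realization X \<iota>)"

section \<open>The cone-off\<close>

text \<open>The arcs \<open>Inr (u, v)\<close> and \<open>Inr (v, u)\<close> form the edge added between \<open>u\<close> and \<open>v\<close>.\<close>

definition cone_arcs :: "('v, 'e) pre_digraph \<Rightarrow> 'v set set \<Rightarrow> ('v \<times> 'v) set" where
  "cone_arcs X \<H> = {(u, v). u \<in> verts X \<and> v \<in> verts X \<and> u \<noteq> v \<and> (\<exists>Y\<in>\<H>. u \<in> Y \<and> v \<in> Y)}"

definition cone_off :: "('v, 'e) pre_digraph \<Rightarrow> 'v set set \<Rightarrow> ('v, 'e + 'v \<times> 'v) pre_digraph" where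
  "cone_off X \<H> = \<lparr>verts = verts X, arcs = Inl ` arcs X \<union> Inr ` cone_arcs X \<H>,
     tail = case_sum (tail X) fst, head = case_sum (head X) snd\<rparr>"

text \<open>The identity outside the set of arcs, as \<^locale>\<open>bidirected_digraph\<close> demands.\<close>

definition cone_off_rev :: "('v, 'e) pre_digraph \<Rightarrow> ('e \<Rightarrow> 'e) \<Rightarrow> 'v set set \<Rightarrow>
    'e + 'v \<times> 'v \<Rightarrow> 'e + 'v \<times> 'v" where
  "cone_off_rev X \<iota> \<H> = map_sum \<iota> (\<lambda>p. if p \<in> cone_arcs X \<H> then prod.swap p else p)"

definition cone_off_arc_action :: "('v, 'e) pre_digraph \<Rightarrow> 'v set set \<Rightarrow>
    ('g \<Rightarrow> 'v \<Rightarrow> 'v) \<Rightarrow> ('g \<Rightarrow> 'e \<Rightarrow> 'e) \<Rightarrow> 'g \<Rightarrow> 'e + 'v \<times> 'v \<Rightarrow> 'e + 'v \<times> 'v" where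
  "cone_off_arc_action X \<H> \<alpha> \<beta> g =
     restrict (map_sum (\<beta> g) (map_prod (\<alpha> g) (\<alpha> g))) (arcs (cone_off X \<H>))"

definition coset_orbits ::
    "('g, 'm) monoid_scheme \<Rightarrow> ('g \<Rightarrow> 'v \<Rightarrow> 'v) \<Rightarrow> 'g set \<Rightarrow> 'v \<Rightarrow> 'v set set" where
  "coset_orbits G \<alpha> H x = {(\<lambda>k. \<alpha> k x) ` (g <#\<^bsub>G\<^esub> H) | g. g \<in> carrier G}"

end

theory Submission
  imports Defs "HOL-Real_Asymp.Real_Asymp"
begin

text \<open>
  Suppose that the cone-off shortens the orbit of \<open>g\<close> by an unbounded factor.  A path in the
  cone-off from \<open>x\<close> to \<open>g\<^sup>n x\<close> projects to an interval \<open>[x, g\<^sup>n x]\<close> of \<open>X\<close>, so one of its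
  edges projects to a long piece; that edge joins two points of some \<open>k H x\<close>, and by
  quasiconvexity \<open>k H x\<close> stays near that piece and near its translates by boundedly many powers
  of \<open>g\<close>.  Acylindricity and the pigeonhole principle then put a positive power of \<open>g\<close> into
  \<open>k H k\<^sup>-\<^sup>1\<close>.  If moreover \<open>g\<close> is not loxodromic on \<open>X\<close>, its powers barely move the
  middle of a long interval, and the same argument shows that \<open>g\<close> has finite order.
\<close>

section \<open>Four-point hyperbolicity for integer-valued metrics\<close>

text \<open>The order in which constants are chosen shapes the argument. Acylindricity needs a
  tolerance fixed beforehand; only the tolerance tells how long the piece must be and how many
  powers of \<open>g\<close> the pigeonhole principle consumes. So the distance from the translated
  pieces to \<open>k H x\<close> must not depend on the number of powers. It does not, since the
  piece may be taken as deep inside \<open>[x, g^n x]\<close> as desired: the displacement of the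
  endpoints enters the required depth, and in the middle only an error proportional to \<delta> is
  left.

  In (2), the case to exclude is an element parabolic on \<open>X\<close> and elliptic on the
  cone-off: finite order would bound its orbits in \<open>X\<close>. The remaining implications come
  from (1) and from the fact that coning off never increases distances.

  All estimates are made for vertices, with distances in the natural numbers. Nothing is lost,
  because the type of an element can be read off from the orbit of any vertex.\<close>

locale hyperbolic_vertices =
  fixes V :: "'v set" and d :: "'v \<Rightarrow> 'v \<Rightarrow> nat" and \<delta> :: nat
  assumes dist_zero: "u \<in> V \<Longrightarrow> v \<in> V \<Longrightarrow> d u v = 0 \<longleftrightarrow> u = v"
    and dist_sym: "u \<in> V \<Longrightarrow> v \<in> V \<Longrightarrow> d u v = d v u"
    and dist_triangle: "u \<in> V \<Longrightarrow> v \<in> V \<Longrightarrow> w \<in> V \<Longrightarrow> d u w \<le> d u v + d v w"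
    and interval_point: "u \<in> V \<Longrightarrow> v \<in> V \<Longrightarrow> s \<le> d u v \<Longrightarrow>
      \<exists>w\<in>V. d u w = s \<and> s + d w v = d u v"
    and four_point: "x \<in> V \<Longrightarrow> y \<in> V \<Longrightarrow> z \<in> V \<Longrightarrow> w \<in> V \<Longrightarrow>
      d x y + d z w \<le> max (d x z + d y w) (d x w + d y z) + \<delta>"
begin

text \<open>
  Twice the Gromov product of \<open>a\<close> and \<open>b\<close> at \<open>q\<close> is at least \<open>r\<close> iff
  \<open>d a b + r \<le> d q a + d q b\<close>; this form avoids truncated subtraction.
\<close>

lemma gromov_product_trans:
  assumes "q \<in> V" "a \<in> V" "b \<in> V" "c \<in> V"
    and "d a b + r \<le> d q a + d q b" "d b c + r \<le> d q b + d q c"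
  shows "d a c + r \<le> d q a + d q c + \<delta>"
proof -
  have "d a c + d b q \<le> max (d a b + d c q) (d a q + d c b) + \<delta>"
    by (intro four_point assms)
  then show ?thesis
    using assms dist_sym[of b q] dist_sym[of c q] dist_sym[of a q] dist_sym[of c b] by auto
qed

text \<open>Splitting the chain in half costs one \<delta> by \<open>gromov_product_trans\<close>,
  so \<open>2 ^ k\<close> steps cost only \<open>k * \<delta>\<close>. This logarithmic loss is why
  a chain avoiding a large ball around a point of an interval has to be exponentially long.\<close>

lemma gromov_product_chain:
  assumes q: "q \<in> V" and w: "\<And>i. i \<le> n \<Longrightarrow> w i \<in> V"
    and step: "\<And>i. i < n \<Longrightarrow> d (w i) (w (Suc i)) + r \<le> d q (w i) + d q (w (Suc i))"
    and n: "0 < n" "n \<le> 2 ^ k"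
  shows "d (w 0) (w n) + r \<le> d q (w 0) + d q (w n) + k * \<delta>"
proof -
  have "d (w i) (w j) + r \<le> d q (w i) + d q (w j) + k * \<delta>"
    if "i < j" "j \<le> n" "j - i \<le> 2 ^ k" for i j
    using that
  proof (induction k arbitrary: i j)
    case 0
    then have "j = Suc i" by auto
    with 0 step[of i] show ?case by simp
  next
    case (Suc k)
    show ?case
    proof (cases "j - i \<le> 2 ^ k")
      case True
      with Suc show ?thesis by fastforce
    next
      case False
      define m where "m = i + 2 ^ k"
      have m: "i < m" "m < j" "m - i \<le> 2 ^ k" "j - m \<le> 2 ^ k"
        using False Suc.prems by (auto simp: m_def)
      have 1: "d (w i) (w m) + r \<le> d q (w i) + d q (w m) + k * \<delta>"
        using Suc m by simp
      have 2: "d (w m) (w j) + r \<le> d q (w m) + d q (w j) + k * \<delta>"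
        using Suc m by simp
      show ?thesis
      \<comment> \<open>If so, the claim is only the triangle inequality; otherwise
        \<open>r - k * \<delta>\<close> is a genuine difference and bounds both halves.\<close>
      proof (cases "r \<le> k * \<delta>")
        case True
        have "d (w i) (w j) \<le> d q (w i) + d q (w j)"
          using dist_triangle[of "w i" q "w j"] dist_sym[of "w i" q] q w Suc.prems by simp
        with True show ?thesis by simp
      next
        case False
        then have "d (w i) (w j) + (r - k * \<delta>) \<le> d q (w i) + d q (w j) + \<delta>"
          using m Suc.prems 1 2
          by (intro gromov_product_trans[of q "w i" "w m" "w j"]) (auto simp: q w)
        with False show ?thesis by simp
      qed
    qed
  qed
  from this[of 0 n] n show ?thesis by simp
qed

text \<open>If \<open>d a w \<le> d a b\<close>, take \<open>q\<close> on the interval at the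
  distance of \<open>w\<close> from \<open>a\<close>: both sums in the maximum of the four-point
  inequality are then at most \<open>d a b + C\<close>. A point \<open>w\<close> farther from
  \<open>a\<close> than \<open>b\<close> is already within \<open>C\<close> of
  \<open>b\<close>.\<close>

lemma near_interval:
  assumes "a \<in> V" "b \<in> V" "w \<in> V" "d a w + d w b \<le> d a b + C"
  shows "\<exists>q\<in>V. d a q + d q b = d a b \<and> d w q \<le> C + \<delta>"
proof (cases "d a w \<le> d a b")
  case True
  then obtain q where q: "q \<in> V" "d a q = d a w" "d a w + d q b = d a b"
    using interval_point assms by blast
  have "d w q + d a b \<le> max (d w a + d q b) (d w b + d q a) + \<delta>"
    using assms q by (intro four_point)
  then show ?thesis using q assms dist_sym[of w a] dist_sym[of q a]
    by (intro bexI[of _ q]) auto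
next
  case False
  then show ?thesis using assms dist_zero[of b b] by (intro bexI[of _ b]) auto
qed

text \<open>At the least \<open>k\<close> with \<open>A * D0 + B \<le> 2 ^ k\<close> the premise
  bounds \<open>D0\<close> linearly in \<open>k\<close>, hence logarithmically in \<open>D0\<close>
  itself. The quantifier order matters: \<open>D\<close> is found before \<open>D0\<close>, which
  will depend on the endpoints of an interval.\<close>

lemma exp_linear_bound:
  fixes A B C \<mu> :: nat
  shows "\<exists>D. \<forall>D0. (\<forall>k. A * D0 + B \<le> 2 ^ k \<longrightarrow> D0 \<le> \<mu> + (k + 2) * C) \<longrightarrow> D0 \<le> D"
proof -
  have "\<forall>\<^sub>F k :: nat in sequentially. real A * (real \<mu> + (real k + 3) * real C) + real B < 2 ^ k"
    by real_asymp
  \<comment> \<open>\<open>k + 3\<close> and not \<open>k + 2\<close>: the premise is used at the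
    least admissible exponent \<open>Suc k'\<close>, the exponential is compared at
    \<open>k'\<close>.\<close>
  then obtain k0 :: nat where
    k0: "\<And>k. k \<ge> k0 \<Longrightarrow> real A * (real \<mu> + (real k + 3) * real C) + real B < 2 ^ k"
    by (auto simp: eventually_at_top_linorder)
  have "D0 \<le> \<mu> + (k0 + 2) * C"
    if D0: "\<And>k. A * D0 + B \<le> 2 ^ k \<Longrightarrow> D0 \<le> \<mu> + (k + 2) * C" for D0
  proof (rule ccontr)
    assume "\<not> ?thesis"
    then have *: "\<not> A * D0 + B \<le> 2 ^ k0" using D0[of k0] by auto
    have "\<exists>k. A * D0 + B \<le> 2 ^ k" by (metis less_exp less_imp_le)
    define k where "k = (LEAST k. A * D0 + B \<le> 2 ^ k)"
    have k: "A * D0 + B \<le> 2 ^ k"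
      unfolding k_def by (rule LeastI_ex) fact
    have "k > k0" using * k
      by (metis less_le_not_le linorder_not_less nle_le one_le_numeral order.trans power_increasing)
    then obtain k' where k': "k = Suc k'" "k' \<ge> k0" by (cases k) auto
    have "\<not> A * D0 + B \<le> 2 ^ k'"
      using not_less_Least[of k' "\<lambda>k. A * D0 + B \<le> 2 ^ k"] k' by (simp add: k_def[symmetric])
    then have "2 ^ k' < A * D0 + B" by simp
    then have "real (2 ^ k') < real (A * D0 + B)" by (rule of_nat_less_iff[THEN iffD2])
    moreover have "D0 \<le> \<mu> + (k' + 3) * C" using D0[OF k] k' by (simp add: algebra_simps)
    then have "real D0 \<le> real (\<mu> + (k' + 3) * C)" by (rule of_nat_mono)
    then have "real D0 \<le> real \<mu> + (real k' + 3) * real C" by simp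
    then have "real A * real D0 \<le> real A * (real \<mu> + (real k' + 3) * real C)"
      by (rule mult_left_mono) simp
    ultimately show False using k0[OF k'(2)] by simp
  qed
  then show ?thesis by blast
qed

text \<open>
  The half of the Morse lemma which places geodesics near quasi-geodesics: \<open>q\<close> is a point of
  an interval \<open>[a, b]\<close> at maximal distance \<open>D0\<close> from \<open>Y\<close>, and the chain joining points of \<open>Y\<close> near
  the points of \<open>[a, b]\<close> at distance \<open>2 D0\<close> on both sides of \<open>q\<close> has length linear in \<open>D0\<close> but
  avoids the ball of radius \<open>D0\<close> around \<open>q\<close>, which forces exponential length.
\<close>

lemma quasiconvex_if_chains:
  assumes YV: "Y \<subseteq> V"
    and chain: "\<And>a b. a \<in> Y \<Longrightarrow> b \<in> Y \<Longrightarrow> \<exists>w n. (\<forall>i\<le>n. w i \<in> Y) \<and> w 0 = a \<and> w n = b \<and>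
      (\<forall>i<n. d (w i) (w (Suc i)) \<le> \<mu>) \<and> n \<le> A * d a b + B"
  shows "\<exists>D. \<forall>a\<in>Y. \<forall>b\<in>Y. \<forall>w\<in>V. d a w + d w b \<le> d a b + C \<longrightarrow> (\<exists>y\<in>Y. d w y \<le> D)"
proof -
  \<comment> \<open>\<open>6 * A\<close>, since the ends of the chain will be at most
    \<open>6 * D0\<close> apart: \<open>4 * D0\<close> between \<open>q1\<close> and
    \<open>q2\<close> and \<open>D0\<close> on each side. \<open>k + 2\<close> counts the losses of
    \<delta>: \<open>k\<close> along the chain and one for attaching each of \<open>q1\<close>,
    \<open>q2\<close>.\<close>
  obtain D where D: "\<And>D0. (\<And>k. (6 * A) * D0 + B \<le> 2 ^ k \<Longrightarrow> D0 \<le> \<mu> + (k + 2) * \<delta>) \<Longrightarrow> D0 \<le> D"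
    using exp_linear_bound[of "6 * A" B \<mu> \<delta>] by blast
  have interval: "\<exists>y\<in>Y. d q y \<le> D"
    if ab: "a \<in> Y" "b \<in> Y" and q0: "q \<in> V" "d a q + d q b = d a b" for a b q
  proof -
    have aV: "a \<in> V" and bV: "b \<in> V" using ab YV by auto
    define P where "P n \<longleftrightarrow> (\<forall>w\<in>V. d a w + d w b = d a b \<longrightarrow> (\<exists>y\<in>Y. d w y \<le> n))" for n
    define D0 where "D0 = (LEAST n. P n)"
    have "P (d a b)"
      unfolding P_def using ab dist_sym aV by (metis le_add1)
    then have D0: "P D0" unfolding D0_def by (rule LeastI)
    have "D0 \<le> D"
    proof (cases "D0 = 0")
      case False
      then have "\<not> P (D0 - 1)" unfolding D0_def by (metis D0_def diff_less neq0_conv not_less_Least zero_less_one)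
      then obtain q where q: "q \<in> V" "d a q + d q b = d a b" and qfar: "\<forall>y\<in>Y. D0 \<le> d q y"
        unfolding P_def by force
      obtain q1 where q1: "q1 \<in> V" "d q q1 = min (2 * D0) (d q a)" "d q q1 + d q1 a = d q a"
        using interval_point[of q a "min (2 * D0) (d q a)"] q aV by auto
      obtain q2 where q2: "q2 \<in> V" "d q q2 = min (2 * D0) (d q b)" "d q q2 + d q2 b = d q b"
        using interval_point[of q b "min (2 * D0) (d q b)"] q bV by auto
      note sym = dist_sym[OF aV q(1)] dist_sym[OF aV q1(1)] dist_sym[OF aV q2(1)]
        dist_sym[OF q(1) q1(1)]
      have tri: "d a b \<le> d a q1 + d q1 b" "d q1 b \<le> d q1 q + d q b" "d q1 b \<le> d q1 q2 + d q2 b"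
        "d a b \<le> d a q2 + d q2 b" "d a q2 \<le> d a q + d q q2" "d q1 q2 \<le> d q1 q + d q q2"
        by (intro dist_triangle aV bV q(1) q1(1) q2(1))+
      have int1: "d a q1 + d q1 b = d a b" and int2: "d a q2 + d q2 b = d a b"
        and between: "d q1 q2 = d q q1 + d q q2"
        using tri sym q q1 q2 by linarith+
      \<comment> \<open>The second conjunct bounds twice the Gromov product of \<open>q1\<close> and
        \<open>y\<close> at \<open>q\<close> below by \<open>D0\<close>; with
        \<open>d q q1 = 2 * D0\<close>, any point within \<open>D0\<close> of \<open>q1\<close>
        satisfies it. If the interval is too short on this side, \<open>q1 = a\<close> is its own
        witness.\<close>
      have "\<exists>y\<in>Y. d q1 y \<le> D0 \<and> d q1 y + D0 \<le> d q q1 + d q y"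
      proof (cases "2 * D0 \<le> d q a")
        case True
        obtain y where "y \<in> Y" "d q1 y \<le> D0" using D0 int1 q1 unfolding P_def by blast
        then show ?thesis using True q1 qfar by auto
      next
        case False
        then have "q1 = a" using q1 dist_zero[of q1 a] aV by simp
        then show ?thesis using ab qfar dist_zero[of a a] aV by (intro bexI[of _ a]) auto
      qed
      then obtain y1 where y1: "y1 \<in> Y" "d q1 y1 \<le> D0" "d q1 y1 + D0 \<le> d q q1 + d q y1" by blast
      have "\<exists>y\<in>Y. d q2 y \<le> D0 \<and> d q2 y + D0 \<le> d q q2 + d q y"
      proof (cases "2 * D0 \<le> d q b")
        case True
        obtain y where "y \<in> Y" "d q2 y \<le> D0" using D0 int2 q2 unfolding P_def by blast
        then show ?thesis using True q2 qfar by auto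
      next
        case False
        then have "q2 = b" using q2 dist_zero[of q2 b] bV by simp
        then show ?thesis using ab qfar dist_zero[of b b] bV by (intro bexI[of _ b]) auto
      qed
      then obtain y2 where y2: "y2 \<in> Y" "d q2 y2 \<le> D0" "d q2 y2 + D0 \<le> d q q2 + d q y2" by blast
      have yV: "y1 \<in> V" "y2 \<in> V" using y1 y2 YV by auto
      have "d y1 y2 \<le> d y1 q1 + d q1 y2" "d q1 y2 \<le> d q1 q2 + d q2 y2"
        by (intro dist_triangle yV q1(1) q2(1))+
      moreover have "d q1 q2 \<le> 4 * D0" using between q1(2) q2(2) by simp
      ultimately have d6: "d y1 y2 \<le> 6 * D0" using y1 y2 dist_sym[of q1 y1] q1 yV by linarith
      obtain w n where w: "\<And>i. i \<le> n \<Longrightarrow> w i \<in> Y" "w 0 = y1" "w n = y2"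
        "\<And>i. i < n \<Longrightarrow> d (w i) (w (Suc i)) \<le> \<mu>" "n \<le> A * d y1 y2 + B"
        using chain[OF y1(1) y2(1)] by auto
      show ?thesis
      proof (rule D)
        fix k :: nat assume k: "(6 * A) * D0 + B \<le> 2 ^ k"
        have "A * d y1 y2 \<le> A * (6 * D0)" using d6 by (rule mult_left_mono) simp
        also have "\<dots> = 6 * A * D0" by simp
        finally have nk: "n \<le> 2 ^ k" using w(5) k by (meson add_mono le_refl le_trans)
        show "D0 \<le> \<mu> + (k + 2) * \<delta>"
        proof (cases "D0 \<le> \<mu> + (k + 2) * \<delta>")
          case far: False
          \<comment> \<open>Consecutive points of the chain are at least \<open>D0\<close> away from
            \<open>q\<close> and at most \<mu> apart, so \<open>r\<close> bounds each doubled
            product from below.\<close>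
          define r where "r = D0 - \<mu>"
          have mid: "d y1 y2 + (r - k * \<delta>) \<le> d q y1 + d q y2"
          proof (cases "n = 0")
            case True
            then have "y1 = y2" using w by simp
            then show ?thesis using qfar[rule_format, OF y1(1)] dist_zero[of y1 y1] yV by (simp add: r_def)
          next
            case False
            have "d (w 0) (w n) + r \<le> d q (w 0) + d q (w n) + k * \<delta>"
            proof (rule gromov_product_chain[OF q(1)])
              fix i assume "i < n"
              then show "d (w i) (w (Suc i)) + r \<le> d q (w i) + d q (w (Suc i))"
                using w(4)[of i] qfar[rule_format, OF w(1)[of i]] qfar[rule_format, OF w(1)[of "Suc i"]]
                  far unfolding r_def by linarith
            qed (use w YV False nk in auto)
            then show ?thesis using w far by (simp add: r_def)
          qed
          have s1: "d q1 y2 + (r - k * \<delta>) \<le> d q q1 + d q y2 + \<delta>"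
            by (rule gromov_product_trans[OF q(1) q1(1) yV]) (use y1 mid in \<open>auto simp: r_def\<close>)
          have "d q1 q2 + (r - (k + 1) * \<delta>) \<le> d q q1 + d q q2 + \<delta>"
            by (rule gromov_product_trans[OF q(1) q1(1) yV(2) q2(1)])
              (use y2 s1 far dist_sym[OF yV(2) q2(1)] in \<open>auto simp: r_def\<close>)
          \<comment> \<open>\<open>q\<close> lies between \<open>q1\<close> and \<open>q2\<close>,
            so their product at \<open>q\<close> vanishes; the bound just obtained forces
            \<open>r \<le> (k + 2) * \<delta>\<close>.\<close>
          then show ?thesis using between by (simp add: r_def)
        qed simp
      qed
    qed simp
    then show ?thesis using D0 q0 unfolding P_def by (meson le_trans)
  qed
  \<comment> \<open>An excess \<open>C\<close> is traded for a detour of length at most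
    \<open>C + \<delta>\<close> to the interval.\<close>
  have "\<exists>y\<in>Y. d w y \<le> C + \<delta> + D"
    if ab: "a \<in> Y" "b \<in> Y" and w: "w \<in> V" "d a w + d w b \<le> d a b + C" for a b w
  proof -
    obtain q where q: "q \<in> V" "d a q + d q b = d a b" "d w q \<le> C + \<delta>"
      using near_interval[OF _ _ w] ab YV by blast
    obtain y where y: "y \<in> Y" "d q y \<le> D" using interval[OF ab q(1,2)] by blast
    show ?thesis using y q dist_triangle[of w q y] w YV by (intro bexI[of _ y]) auto
  qed
  then show ?thesis by blast
qed

section \<open>Points near an interval and their displacement by isometries\<close>

text \<open>
  \<open>d x u - d y u\<close> serves as the coordinate of the projection of \<open>u\<close> to an interval \<open>[x, y]\<close>.
\<close>

lemma fellow_travel: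
  assumes V: "x \<in> V" "y \<in> V" "a \<in> V" "b \<in> V" "w \<in> V"
    and apart: "d x a + d y b + \<delta> < d x b + d y a"
    and aw: "d x a + d y w \<le> d x w + d y a" and wb: "d x w + d y b \<le> d x b + d y w"
    and e: "d x w + d w y \<le> d x y + e"
  shows "d a w + d w b \<le> d a b + (e + 3 * \<delta>)"
proof -
  note sym = dist_sym[OF V(1,3)] dist_sym[OF V(1,4)] dist_sym[OF V(1,5)] dist_sym[OF V(2,3)]
    dist_sym[OF V(2,4)] dist_sym[OF V(2,5)] dist_sym[OF V(4,5)] dist_sym[OF V(3,5)]
  \<comment> \<open>The order of the coordinates decides each maximum: \<open>a\<close> before
    \<open>w\<close>, \<open>w\<close> before \<open>b\<close>, and \<open>a\<close> before
    \<open>b\<close> by more than \<delta>. Adding the three inequalities costs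
    \<open>3 * \<delta>\<close>.\<close>
  have "d a w + d x y \<le> max (d a x + d w y) (d a y + d w x) + \<delta>" by (intro four_point V)
  moreover have "d b w + d x y \<le> max (d b x + d w y) (d b y + d w x) + \<delta>" by (intro four_point V)
  moreover have "d a y + d b x \<le> max (d a b + d y x) (d a x + d y b) + \<delta>" by (intro four_point V)
  ultimately show ?thesis using sym dist_sym[OF V(1,2)] apart aw wb e by linarith
qed

text \<open>Seen from \<open>w\<close>, the doubled Gromov products of \<open>x'\<close>,
  \<open>x\<close> and of \<open>y\<close>, \<open>y'\<close> exceed \<open>2 * \<delta>\<close>. If
  that of \<open>x\<close>, \<open>y\<close> did so too, two transitivity steps would leave a
  positive product of \<open>x'\<close> and \<open>y'\<close>, impossible as \<open>w\<close> lies
  between them.\<close>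

lemma excess_bound:
  assumes V: "x \<in> V" "y \<in> V" "x' \<in> V" "y' \<in> V" "w \<in> V"
    and w: "d x' w + d w y' = d x' y'"
    and far: "d x x' + 2 * \<delta> < d x' w" "d y y' + 2 * \<delta> < d w y'"
  shows "d x w + d w y \<le> d x y + 2 * \<delta>"
proof (rule ccontr)
  assume neg: "\<not> ?thesis"
  note sym = dist_sym[OF V(1,5)] dist_sym[OF V(3,5)] dist_sym[OF V(1,3)]
  have "d x' y + (2 * \<delta> + 1) \<le> d w x' + d w y + \<delta>"
    by (rule gromov_product_trans[of w x' x y]) (use V sym far neg in auto)
  then have "d x' y' + (\<delta> + 1) \<le> d w x' + d w y' + \<delta>"
    by (intro gromov_product_trans[of w x' y y']) (use V far in auto)
  then show False using w sym by simp
qed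

text \<open>Primed points are images under an isometry, so the distances of \<open>p'\<close> from
  \<open>x\<close> and \<open>y\<close> exceed those of \<open>p\<close> by at most
  \<open>t\<close>. As \<open>p\<close> lies on the interval, the four-point inequality leaves
  \<open>t + \<delta>\<close> for \<open>d p p'\<close>.\<close>

lemma displacement_le:
  assumes V: "x \<in> V" "y \<in> V" "p \<in> V" "x' \<in> V" "y' \<in> V" "p' \<in> V"
    and p: "d x p + d p y = d x y" and eq: "d x' p' = d x p" "d p' y' = d p y"
    and t: "d x x' \<le> t" "d y y' \<le> t"
  shows "d p p' \<le> t + \<delta>"
proof -
  have "d p p' + d x y \<le> max (d p x + d p' y) (d p y + d p' x) + \<delta>" by (intro four_point V)
  moreover have "d p' y \<le> d p' y' + d y' y" "d x p' \<le> d x x' + d x' p'"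
    by (intro dist_triangle V)+
  ultimately show ?thesis
    using dist_sym[of p x] dist_sym[of p' x] dist_sym[of y' y] V p eq t by linarith
qed

text \<open>Here \<open>x', y', p'\<close> and \<open>p''\<close> stand for the images under \<open>f\<close>, resp. \<open>f\<^sup>2\<close>.\<close>

lemma displacement_le_of_no_drift:
  assumes V: "x \<in> V" "y \<in> V" "p \<in> V" "x' \<in> V" "y' \<in> V" "p' \<in> V" "p'' \<in> V"
    and p: "d x p + d p y = d x y" and eq: "d x' p' = d x p" "d p' y' = d p y"
      "d x' p'' = d x p'" "d p'' y' = d p' y" "d p' p'' = d p p'"
    and t: "d x x' \<le> t" "d y y' \<le> t"
    and drift: "d p p'' \<le> d p p' + \<delta>"
    and far: "t + \<delta> < d x p" "t + \<delta> < d p y"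
  shows "d p p' \<le> 4 * \<delta>"
proof -
  note sym = dist_sym[OF V(1,3)] dist_sym[OF V(1,4)] dist_sym[OF V(1,6)] dist_sym[OF V(1,7)]
    dist_sym[OF V(2,5)] dist_sym[OF V(3,7)] dist_sym[OF V(6,7)] dist_sym[OF V(4,6)]
    dist_sym[OF V(4,7)]
  have "d p p' \<le> t + \<delta>" using displacement_le[OF V(1-6) p eq(1,2) t] .
  \<comment> \<open>By this inequality \<open>p'\<close> is farther than \<open>p\<close> from one
    of \<open>x\<close>, \<open>y\<close> by at least \<open>d p p' - \<delta>\<close>. The next two
    inequalities double the gain for \<open>p''\<close> up to multiples of \<delta>, while
    \<open>drift\<close> allows only \<open>d p p' + \<delta>\<close>. The depth \<open>far\<close>
    settles the alternatives involving \<open>d x' x\<close> and \<open>d y' y\<close>.\<close>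
  moreover have "d p p' + d x y \<le> max (d p x + d p' y) (d p y + d p' x) + \<delta>"
    by (intro four_point V)
  moreover have "d p'' y' + d p' y \<le> max (d p'' p' + d y' y) (d p'' y + d y' p') + \<delta>"
    by (intro four_point V)
  moreover have "d p'' x' + d p' x \<le> max (d p'' p' + d x' x) (d p'' x + d x' p') + \<delta>"
    by (intro four_point V)
  moreover have "d p'' y \<le> d p'' p + d p y" "d p'' x \<le> d p'' p + d p x"
    by (intro dist_triangle V)+
  moreover have "d y' p' = d p' y'" using dist_sym V by blast
  ultimately show ?thesis using p eq t drift far sym by linarith
qed

text \<open>Once the second step gains more than \<delta> over the first, the four-point inequality
  for \<open>z 0\<close>, \<open>z 1\<close>, \<open>z 2\<close>, \<open>z (n + 2)\<close>
  propagates strict growth: as \<open>a n < a (Suc n)\<close>, the maximum must be the sum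
  containing \<open>a (n + 2)\<close>. Integrality turns strict growth into slope one.\<close>

lemma drift_imp_linear_growth:
  assumes V: "\<And>n. z n \<in> V" and inv: "\<And>m n. d (z m) (z (m + n)) = a n"
    and drift: "a 1 + \<delta> < a 2"
  shows "n \<le> a n"
proof -
  have step: "a n < a (Suc n)" for n
  proof (induction n)
    case 0
    have "d (z 0) (z 2) \<le> d (z 0) (z 1) + d (z 1) (z 2)" by (intro dist_triangle V)
    then show ?case using inv[of 0 0] dist_zero[of "z 0" "z 0"] V inv[of 0 2] inv[of 0 1] inv[of 1 1] drift
      by (simp add: numeral_2_eq_2)
  next
    case (Suc n)
    have "d (z 0) (z 2) + d (z 1) (z (n + 2)) \<le>
        max (d (z 0) (z 1) + d (z 2) (z (n + 2))) (d (z 0) (z (n + 2)) + d (z 2) (z 1)) + \<delta>"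
      by (intro four_point V)
    moreover have "d (z 2) (z 1) = a 1" using dist_sym[OF V V, of 2 1] inv[of 1 1]
      by (simp add: numeral_2_eq_2)
    moreover have "d (z 1) (z (n + 2)) = a (Suc n)" "d (z 2) (z (n + 2)) = a n"
      "d (z 0) (z (n + 2)) = a (Suc (Suc n))" "d (z 0) (z 2) = a 2" "d (z 0) (z 1) = a 1"
      using inv[of 1 "Suc n"] inv[of 2 n] inv[of 0 "n + 2"] inv[of 0 2] inv[of 0 1]
      by (simp_all add: numeral_2_eq_2)
    ultimately show ?case using drift Suc by linarith
  qed
  show ?thesis by (induction n) (use step in \<open>auto intro: le_less_trans Suc_leI\<close>)
qed

end

section \<open>Isometric actions and coned-off cosets\<close>

text \<open>Telescoping: steps raising \<tau> by at most \<open>K\<close> each would raise it by at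
  most \<open>K * m\<close> in total. This singles out the edge with a long projection.\<close>

lemma relpow_increment:
  fixes \<tau> :: "'a \<Rightarrow> int"
  assumes "(u, v) \<in> S ^^ m" "K * int m < \<tau> v - \<tau> u"
  shows "\<exists>(a, b)\<in>S. K < \<tau> b - \<tau> a"
  using assms
proof (induction m arbitrary: v)
  case (Suc m)
  then obtain w where w: "(u, w) \<in> S ^^ m" "(w, v) \<in> S" by auto
  show ?case
  proof (cases "K < \<tau> v - \<tau> w")
    case False
    with Suc.prems(2) have "K * int m < \<tau> w - \<tau> u" by (simp add: algebra_simps)
    then show ?thesis using Suc.IH w by blast
  qed (use w in blast)
qed simp

locale isometric_vertex_action = hyperbolic_vertices V d \<delta> + group G
  for V :: "'v set" and d \<delta> and G :: "('g, 'm) monoid_scheme" (structure) +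
  fixes \<alpha> :: "'g \<Rightarrow> 'v \<Rightarrow> 'v"
  assumes act_closed [simp]: "g \<in> carrier G \<Longrightarrow> u \<in> V \<Longrightarrow> \<alpha> g u \<in> V"
    and act_one [simp]: "u \<in> V \<Longrightarrow> \<alpha> \<one> u = u"
    and act_mult: "g \<in> carrier G \<Longrightarrow> h \<in> carrier G \<Longrightarrow> u \<in> V \<Longrightarrow> \<alpha> (g \<otimes> h) u = \<alpha> g (\<alpha> h u)"
    and act_isometry [simp]: "g \<in> carrier G \<Longrightarrow> u \<in> V \<Longrightarrow> v \<in> V \<Longrightarrow> d (\<alpha> g u) (\<alpha> g v) = d u v"
begin

lemma act_inv_cancel [simp]:
  assumes "g \<in> carrier G" "u \<in> V"
  shows "\<alpha> (inv g) (\<alpha> g u) = u" "\<alpha> g (\<alpha> (inv g) u) = u"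
  using assms by (simp_all flip: act_mult)

lemma dist_act_inv:
  assumes "g \<in> carrier G" "u \<in> V" "v \<in> V"
  shows "d u (\<alpha> (inv g) v) = d (\<alpha> g u) v"
  using act_isometry[of g u "\<alpha> (inv g) v"] assms by simp

lemma act_pow_commute:
  assumes "g \<in> carrier G" "u \<in> V"
  shows "\<alpha> (g [^] (l::nat)) (\<alpha> (g [^] (n::nat)) u) = \<alpha> (g [^] n) (\<alpha> (g [^] l) u)"
  using assms by (simp add: nat_pow_mult add.commute flip: act_mult)

end

text \<open>The hypotheses on \<open>H\<close>, brought to the base point \<open>x\<close>.
  \<open>chains\<close> expresses the quasi-isometric embedding, with words read as paths of step
  length at most \<mu>; in \<open>acylindrical\<close> one of the two far points is
  \<open>x\<close>. By \<open>finite_balls\<close> only finitely many \<open>a\<close> lie at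
  bounded distance, and the pigeonhole argument unites the finite sets belonging to them.\<close>

locale coned_action = isometric_vertex_action V d \<delta> G \<alpha>
  for V :: "'v set" and d \<delta> and G :: "('g, 'm) monoid_scheme" (structure) and \<alpha> +
  fixes H :: "'g set" and x :: 'v and \<mu> A B :: nat
  assumes subgroup_H: "subgroup H G"
    and x_in [simp]: "x \<in> V"
    and finite_balls: "finite {h \<in> H. d x (\<alpha> h x) \<le> \<rho>}"
    and chains: "h \<in> H \<Longrightarrow> h' \<in> H \<Longrightarrow> \<exists>w n. (\<forall>i\<le>n. w i \<in> H) \<and> w 0 = h \<and> w n = h' \<and>
      (\<forall>i<n. d (\<alpha> (w i) x) (\<alpha> (w (Suc i)) x) \<le> \<mu>) \<and> n \<le> A * d (\<alpha> h x) (\<alpha> h' x) + B"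
    and acylindrical: "\<exists>R. \<forall>a\<in>H. R \<le> d x (\<alpha> a x) \<longrightarrow>
      finite {u \<in> carrier G. d x (\<alpha> u x) \<le> \<epsilon> \<and> d (\<alpha> a x) (\<alpha> u (\<alpha> a x)) \<le> \<epsilon>}"
begin

lemma H_closed [simp]: "h \<in> H \<Longrightarrow> h \<in> carrier G"
  using subgroup_H by (rule subgroup.mem_carrier)

text \<open>Contains the edges of the cone-off, expressed through \<open>d\<close> alone;
  \<open>d u v \<le> 1\<close> covers the edges of the original graph, loops included.\<close>

definition cone_step :: "('v \<times> 'v) set" where
  "cone_step = {(u, v). u \<in> V \<and> v \<in> V \<and> (d u v \<le> 1 \<or>
     (\<exists>k\<in>carrier G. \<exists>h\<in>H. \<exists>h'\<in>H. u = \<alpha> k (\<alpha> h x) \<and> v = \<alpha> k (\<alpha> h' x)))}"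

text \<open>One \<open>D\<close> serves all cosets: \<open>inv k\<close> carries
  \<open>k H x\<close> isometrically to \<open>H x\<close>, which is quasiconvex because
  \<open>chains\<close> joins its points.\<close>

lemma coset_quasiconvex:
  "\<exists>D. \<forall>k\<in>carrier G. \<forall>h\<in>H. \<forall>h'\<in>H. \<forall>w\<in>V.
     d (\<alpha> k (\<alpha> h x)) w + d w (\<alpha> k (\<alpha> h' x)) \<le> d (\<alpha> k (\<alpha> h x)) (\<alpha> k (\<alpha> h' x)) + C \<longrightarrow>
     (\<exists>h\<in>H. d w (\<alpha> k (\<alpha> h x)) \<le> D)"
proof -
  define Y where "Y = (\<lambda>h. \<alpha> h x) ` H"
  have "\<exists>w n. (\<forall>i\<le>n. w i \<in> Y) \<and> w 0 = a \<and> w n = b \<and>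
      (\<forall>i<n. d (w i) (w (Suc i)) \<le> \<mu>) \<and> n \<le> A * d a b + B" if "a \<in> Y" "b \<in> Y" for a b
  proof -
    obtain h h' where h: "h \<in> H" "h' \<in> H" and ab: "a = \<alpha> h x" "b = \<alpha> h' x"
      using \<open>a \<in> Y\<close> \<open>b \<in> Y\<close> unfolding Y_def by blast
    obtain w n where "\<forall>i\<le>n. w i \<in> H" "w 0 = h" "w n = h'"
      "\<forall>i<n. d (\<alpha> (w i) x) (\<alpha> (w (Suc i)) x) \<le> \<mu>" "n \<le> A * d (\<alpha> h x) (\<alpha> h' x) + B"
      using chains[OF h] by blast
    then show ?thesis unfolding ab
      by (intro exI[of _ "\<lambda>i. \<alpha> (w i) x"] exI[of _ n]) (auto simp: Y_def)
  qed
  moreover have YV: "Y \<subseteq> V" by (auto simp: Y_def)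
  ultimately obtain D where D: "\<And>a b w. a \<in> Y \<Longrightarrow> b \<in> Y \<Longrightarrow> w \<in> V \<Longrightarrow>
      d a w + d w b \<le> d a b + C \<Longrightarrow> \<exists>y\<in>Y. d w y \<le> D"
    using quasiconvex_if_chains[of Y \<mu> A B C] by blast
  show ?thesis
  proof (intro exI ballI impI)
    fix k h h' w assume k: "k \<in> carrier G" and h: "h \<in> H" "h' \<in> H" and w: "w \<in> V"
      and le: "d (\<alpha> k (\<alpha> h x)) w + d w (\<alpha> k (\<alpha> h' x)) \<le>
        d (\<alpha> k (\<alpha> h x)) (\<alpha> k (\<alpha> h' x)) + C"
    have "d (\<alpha> (inv k) w) (\<alpha> h' x) = d (\<alpha> k (\<alpha> h' x)) w"
      using dist_act_inv[of k "\<alpha> h' x" w] k h w dist_sym[of "\<alpha> (inv k) w" "\<alpha> h' x"] by simp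
    then have "d (\<alpha> h x) (\<alpha> (inv k) w) + d (\<alpha> (inv k) w) (\<alpha> h' x) \<le> d (\<alpha> h x) (\<alpha> h' x) + C"
      using le k h w dist_sym[of w "\<alpha> k (\<alpha> h' x)"] by (simp add: dist_act_inv)
    then obtain y where y: "y \<in> Y" "d (\<alpha> (inv k) w) y \<le> D"
      using D[of "\<alpha> h x" "\<alpha> h' x" "\<alpha> (inv k) w"] h k w unfolding Y_def by auto
    then obtain h'' where h'': "h'' \<in> H" "y = \<alpha> h'' x" unfolding Y_def by blast
    have "d w (\<alpha> k (\<alpha> h'' x)) = d (\<alpha> (inv k) w) (\<alpha> h'' x)"
      using dist_act_inv[of "k" "\<alpha> h'' x" w] k h'' w dist_sym[of "\<alpha> (inv k) w" "\<alpha> h'' x"]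
        dist_sym[of w "\<alpha> k (\<alpha> h'' x)"] by simp
    then show "\<exists>h\<in>H. d w (\<alpha> k (\<alpha> h x)) \<le> D" using y h'' by metis
  qed
qed

text \<open>\<open>D\<close> comes before \<open>J\<close>, \<open>R\<close> and \<open>T\<close>:
  the translates of a deep point have an excess bounded in terms of \<delta> alone, over
  \<open>[x, y]\<close> and then over the ends of the long edge. \<open>T\<close> keeps
  \<open>p\<close> and \<open>q\<close> deep for the torsion argument.\<close>

lemma coset_follows_orbit:
  assumes g: "g \<in> carrier G"
    and short: "\<And>K::nat. \<exists>(n::nat) m. (x, \<alpha> (g [^] n) x) \<in> cone_step ^^ m \<and>
      K * m < d x (\<alpha> (g [^] n) x)"
  shows "\<exists>D. \<forall>J R T. \<exists>n::nat. \<exists>k\<in>carrier G. \<exists>p\<in>V. \<exists>q\<in>V. d p q = R \<and>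
    (\<forall>w\<in>{p, q}. T \<le> d x w \<and> T \<le> d w (\<alpha> (g [^] n) x) \<and>
       d x w + d w (\<alpha> (g [^] n) x) = d x (\<alpha> (g [^] n) x) \<and>
       (\<forall>l\<le>J. \<exists>h\<in>H. d (\<alpha> (g [^] (l::nat)) w) (\<alpha> k (\<alpha> h x)) \<le> D))"
proof -
  obtain D where D: "\<And>k h h' w. k \<in> carrier G \<Longrightarrow> h \<in> H \<Longrightarrow> h' \<in> H \<Longrightarrow> w \<in> V \<Longrightarrow>
     d (\<alpha> k (\<alpha> h x)) w + d w (\<alpha> k (\<alpha> h' x)) \<le> d (\<alpha> k (\<alpha> h x)) (\<alpha> k (\<alpha> h' x)) + 5 * \<delta> \<Longrightarrow>
     \<exists>h\<in>H. d w (\<alpha> k (\<alpha> h x)) \<le> D"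
    using coset_quasiconvex[of "5 * \<delta>"] by blast
  show ?thesis
  proof (rule exI[of _ D], intro allI)
    fix J R T :: nat
    \<comment> \<open>Bounds the displacement of \<open>x\<close>, and also of \<open>g^n x\<close>
      because powers of \<open>g\<close> commute, by all powers up to \<open>J\<close>.\<close>
    define T0 where "T0 = (\<Sum>l\<le>J. d x (\<alpha> (g [^] (l::nat)) x))"
    define T2 where "T2 = T + T0 + 2 * \<delta> + 1"
    \<comment> \<open>\<tau> below runs at twice the speed of the distance: \<open>2 * R\<close>
      makes room for a piece of length \<open>R\<close>, \<open>4 * T2\<close> for a margin
      \<open>2 * T2\<close> at both ends; \<open>3\<close> covers the rounding and excludes edges
      with \<open>d a b \<le> 1\<close>, which change \<tau> by at most \<open>2\<close>.\<close>
    define K where "K = 4 * T2 + 2 * R + 3"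
    obtain n m :: nat where nm: "(x, \<alpha> (g [^] n) x) \<in> cone_step ^^ m" "K * m < d x (\<alpha> (g [^] n) x)"
      using short[of K] by blast
    define y where "y = \<alpha> (g [^] n) x"
    have y [simp]: "y \<in> V" using g by (simp add: y_def)
    define \<tau> where "\<tau> u = int (d x u) - int (d y u)" for u
    have \<tau>_bounds: "- int (d x y) \<le> \<tau> u" "\<tau> u \<le> int (d x y)" if "u \<in> V" for u
      using dist_triangle[of x y u] dist_triangle[of y x u] dist_triangle[of x u y] that
        dist_sym[of x y] dist_sym[of u x] unfolding \<tau>_def by simp_all
    have \<tau>_lip: "\<bar>\<tau> u - \<tau> v\<bar> \<le> 2 * int (d u v)" if "u \<in> V" "v \<in> V" for u v
      using dist_triangle[of x u v] dist_triangle[of x v u] dist_triangle[of y u v]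
        dist_triangle[of y v u] that dist_sym[of u v] unfolding \<tau>_def by simp
    have "\<tau> x = - int (d x y)" "\<tau> y = int (d x y)"
      using dist_zero[of x x] dist_zero[of y y] dist_sym[of y x] by (simp_all add: \<tau>_def)
    moreover have "int K * int m < int (d x y)" using nm(2) unfolding y_def by (metis of_nat_less_iff of_nat_mult)
    ultimately obtain a b where ab: "(a, b) \<in> cone_step" "int K < \<tau> b - \<tau> a"
      using relpow_increment[where S = cone_step and K = "int K" and \<tau> = \<tau> and u = x and v = y and m = m] nm(1) unfolding y_def[symmetric] by auto
    have abV: "a \<in> V" "b \<in> V" using ab by (auto simp: cone_step_def)
    have "\<not> d a b \<le> 1"
      using \<tau>_lip[OF abV] ab(2) unfolding K_def by linarith
    then obtain k h h' where k: "k \<in> carrier G" and h: "h \<in> H" "h' \<in> H"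
      and ab_eq: "a = \<alpha> k (\<alpha> h x)" "b = \<alpha> k (\<alpha> h' x)"
      using ab(1) unfolding cone_step_def by blast
    have near: "T \<le> d x w \<and> T \<le> d w y \<and> (\<forall>l\<le>J. \<exists>h\<in>H. d (\<alpha> (g [^] (l::nat)) w) (\<alpha> k (\<alpha> h x)) \<le> D)"
      if w: "w \<in> V" "d x w + d w y = d x y" and \<tau>w: "\<tau> a + 2 * T2 \<le> \<tau> w" "\<tau> w + 2 * T2 \<le> \<tau> b" for w
    proof -
      \<comment> \<open>On the interval \<open>\<tau> w = 2 * d x w - d x y\<close>, so a margin
        \<open>2 * T2\<close> in \<tau> becomes depth \<open>T2\<close>.\<close>
      have far: "T2 \<le> d x w" "T2 \<le> d w y"
        using \<tau>w w \<tau>_bounds[OF abV(1)] \<tau>_bounds[OF abV(2)] dist_sym[of y w] unfolding \<tau>_def by simp_all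
      have "\<exists>h\<in>H. d (\<alpha> (g [^] l) w) (\<alpha> k (\<alpha> h x)) \<le> D" if "l \<le> J" for l :: nat
      proof -
        define f where "f = \<alpha> (g [^] l)"
        have fV [simp]: "f u \<in> V" if "u \<in> V" for u using that g by (simp add: f_def)
        have fd [simp]: "d (f u) (f v) = d u v" if "u \<in> V" "v \<in> V" for u v
          using that g by (simp add: f_def)
        have t: "d x (f x) \<le> T0"
          unfolding T0_def f_def using that by (intro member_le_sum) auto
        have "d y (f y) = d x (f x)"
          using g unfolding y_def f_def by (simp add: act_pow_commute[of g x l n])
        with t have t': "d y (f y) \<le> T0" by simp
        have "d w (f w) \<le> T0 + \<delta>"
          by (rule displacement_le[of x y w "f x" "f y"]) (use w t t' in auto)
        then have \<tau>: "\<bar>\<tau> w - \<tau> (f w)\<bar> \<le> 2 * T2"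
          using \<tau>_lip[of w "f w"] w unfolding T2_def by simp
        have "d x (f w) + d (f w) y \<le> d x y + 2 * \<delta>"
          by (rule excess_bound[of x y "f x" "f y"]) (use w t t' far in \<open>auto simp: T2_def\<close>)
        \<comment> \<open>Origin of the \<open>5 * \<delta>\<close> fed into quasiconvexity:
          \<open>2 * \<delta>\<close> of excess over \<open>[x, y]\<close> and
          \<open>3 * \<delta>\<close> from the comparison with \<open>[a, b]\<close>.\<close>
        then have "d a (f w) + d (f w) b \<le> d a b + (2 * \<delta> + 3 * \<delta>)"
        proof (rule fellow_travel[rotated -1])
          show "d x a + d y b + \<delta> < d x b + d y a"
            using ab(2) unfolding \<tau>_def K_def T2_def by simp
          show "d x a + d y (f w) \<le> d x (f w) + d y a" "d x (f w) + d y b \<le> d x b + d y (f w)"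
            using \<tau> \<tau>w unfolding \<tau>_def by linarith+
        qed (use w abV in simp_all)
        then show ?thesis using D[of k h h' "f w"] g k h w unfolding ab_eq f_def by simp
      qed
      then show ?thesis using far by (simp add: T2_def)
    qed
    define c where "c = \<tau> a + int (d x y) + 2 * int T2"
    \<comment> \<open>Solves \<open>2 * s - d x y \<ge> \<tau> a + 2 * T2\<close>, the left side
      being the coordinate of \<open>p\<close>, with the half rounded up.\<close>
    define s where "s = nat ((c + 1) div 2)"
    have "c \<ge> 0" using \<tau>_bounds[OF abV(1)] unfolding c_def by simp
    then have s: "c \<le> 2 * int s" "2 * int s \<le> c + 1" unfolding s_def by simp_all
    have sR: "s + R \<le> d x y" using s ab(2) \<tau>_bounds[OF abV(2)] unfolding c_def K_def by simp
    then obtain p where p: "p \<in> V" "d x p = s" "s + d p y = d x y"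
      using interval_point[of x y s] by auto
    with sR have "R \<le> d p y" by simp
    then obtain q where q: "q \<in> V" "d p q = R" "R + d q y = d p y"
      using interval_point[of p y R] p by auto
    have xq: "d x q = s + R"
      using dist_triangle[of x p q] dist_triangle[of x q y] p q by simp
    have "\<tau> p = 2 * int s - int (d x y)" "\<tau> q = 2 * int (s + R) - int (d x y)"
      using p q xq dist_sym[of y p] dist_sym[of y q] unfolding \<tau>_def by simp_all
    then show "\<exists>n::nat. \<exists>k\<in>carrier G. \<exists>p\<in>V. \<exists>q\<in>V. d p q = R \<and>
      (\<forall>w\<in>{p, q}. T \<le> d x w \<and> T \<le> d w (\<alpha> (g [^] n) x) \<and>
         d x w + d w (\<alpha> (g [^] n) x) = d x (\<alpha> (g [^] n) x) \<and>
         (\<forall>l\<le>J. \<exists>h\<in>H. d (\<alpha> (g [^] (l::nat)) w) (\<alpha> k (\<alpha> h x)) \<le> D))"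
      using near[of p] near[of q] p q xq k s ab(2)
      by (intro exI[of _ n] bexI[of _ k] bexI[of _ p] bexI[of _ q])
        (auto simp: c_def K_def simp flip: y_def)
  qed
qed

text \<open>For fixed \<open>a\<close> and \<open>b\<close>, two elements carrying \<open>x\<close>
  and \<open>b x\<close> to within \<epsilon> of \<open>x\<close> and \<open>a x\<close> differ by
  one that moves \<open>x\<close> and \<open>b x\<close> by at most \<open>2 * \<epsilon>\<close>;
  acylindricity admits finitely many. \<open>R0\<close> precedes \<open>R1\<close>, so
  \<open>R1\<close> may be chosen beyond \<open>R0\<close>, and only finitely many \<open>a\<close>,
  \<open>b\<close> remain within \<open>R1\<close>.\<close>

lemma coset_pigeonhole:
  "\<exists>R0. \<forall>R1. \<exists>J. \<forall>v b a. b \<in> H \<longrightarrow> R0 \<le> d x (\<alpha> b x) \<longrightarrow> d x (\<alpha> b x) \<le> R1 \<longrightarrow>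
     (\<forall>l\<le>J. v l \<in> carrier G \<and> a l \<in> H \<and> d x (\<alpha> (a l) x) \<le> R1 \<and> d x (\<alpha> (v l) x) \<le> \<epsilon> \<and>
        d (\<alpha> (v l) (\<alpha> b x)) (\<alpha> (a l) x) \<le> \<epsilon>) \<longrightarrow>
     (\<exists>(l::nat) l'. l < l' \<and> l' \<le> J \<and> v l = v l')"
proof -
  obtain R0 where R0: "\<And>a. a \<in> H \<Longrightarrow> R0 \<le> d x (\<alpha> a x) \<Longrightarrow>
      finite {u \<in> carrier G. d x (\<alpha> u x) \<le> 2 * \<epsilon> \<and> d (\<alpha> a x) (\<alpha> u (\<alpha> a x)) \<le> 2 * \<epsilon>}"
    using acylindrical[of "2 * \<epsilon>"] by blast
  define U where "U b a = {u \<in> carrier G. d x (\<alpha> u x) \<le> \<epsilon> \<and> d (\<alpha> u (\<alpha> b x)) (\<alpha> a x) \<le> \<epsilon>}" for b a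
  have fin: "finite (U b a)" if b: "b \<in> H" "R0 \<le> d x (\<alpha> b x)" and a: "a \<in> H" for a b
  proof (cases "U b a = {}")
    case False
    then obtain u0 where u0: "u0 \<in> U b a" by blast
    define W where "W = {u \<in> carrier G. d x (\<alpha> u x) \<le> 2 * \<epsilon> \<and> d (\<alpha> b x) (\<alpha> u (\<alpha> b x)) \<le> 2 * \<epsilon>}"
    have "U b a \<subseteq> (\<lambda>w. u0 \<otimes> w) ` W"
    proof
      fix u assume u: "u \<in> U b a"
      have c: "u \<in> carrier G" "u0 \<in> carrier G" using u u0 by (auto simp: U_def)
      have "d (\<alpha> u0 x) (\<alpha> u x) \<le> d (\<alpha> u0 x) x + d x (\<alpha> u x)"
        by (rule dist_triangle) (use c in auto)
      moreover have "d (\<alpha> u0 (\<alpha> b x)) (\<alpha> u (\<alpha> b x)) \<le>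
          d (\<alpha> u0 (\<alpha> b x)) (\<alpha> a x) + d (\<alpha> a x) (\<alpha> u (\<alpha> b x))"
        by (rule dist_triangle) (use c b a in auto)
      ultimately have "inv u0 \<otimes> u \<in> W"
        using u u0 c a b dist_sym[of "\<alpha> u0 x" x] dist_sym[of "\<alpha> a x" "\<alpha> u (\<alpha> b x)"]
        unfolding W_def U_def by (simp add: act_mult dist_act_inv)
      moreover have "u = u0 \<otimes> (inv u0 \<otimes> u)" using c by (simp flip: m_assoc)
      ultimately show "u \<in> (\<lambda>w. u0 \<otimes> w) ` W" by blast
    qed
    then show ?thesis using R0[OF b] finite_surj unfolding W_def by blast
  qed simp
  show ?thesis
  proof (rule exI[of _ R0], intro allI)
    fix R1
    define A1 where "A1 = {h \<in> H. d x (\<alpha> h x) \<le> R1}"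
    define UU where "UU = (\<Union>b\<in>{b\<in>A1. R0 \<le> d x (\<alpha> b x)}. \<Union>a\<in>A1. U b a)"
    have "finite UU"
      unfolding UU_def using finite_balls[of R1]
      by (intro finite_UN_I fin) (auto simp: A1_def intro: rev_finite_subset)
    \<comment> \<open>The indices \<open>0, ..., card UU\<close> are one more than the available
      values.\<close>
    have main: "\<exists>l l'. l < l' \<and> l' \<le> card UU \<and> v l = v l'"
      if b: "b \<in> H" "R0 \<le> d x (\<alpha> b x)" "d x (\<alpha> b x) \<le> R1"
        and v: "\<forall>l\<le>card UU. v l \<in> carrier G \<and> a l \<in> H \<and> d x (\<alpha> (a l) x) \<le> R1 \<and>
          d x (\<alpha> (v l) x) \<le> \<epsilon> \<and> d (\<alpha> (v l) (\<alpha> b x)) (\<alpha> (a l) x) \<le> \<epsilon>" for v b a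
    proof -
      have "v ` {..card UU} \<subseteq> UU" using b v unfolding UU_def A1_def U_def by blast
      then have "card (v ` {..card UU}) \<le> card UU" using \<open>finite UU\<close> by (rule card_mono[rotated])
      then have "\<not> inj_on v {..card UU}" using card_image[of v "{..card UU}"] by fastforce
      then obtain i j where "i \<le> card UU" "j \<le> card UU" "i \<noteq> j" "v i = v j"
        by (auto simp: inj_on_def)
      then show ?thesis by (metis linorder_neqE_nat)
    qed
    show "\<exists>J. \<forall>v b a. b \<in> H \<longrightarrow> R0 \<le> d x (\<alpha> b x) \<longrightarrow> d x (\<alpha> b x) \<le> R1 \<longrightarrow>
     (\<forall>l\<le>J. v l \<in> carrier G \<and> a l \<in> H \<and> d x (\<alpha> (a l) x) \<le> R1 \<and> d x (\<alpha> (v l) x) \<le> \<epsilon> \<and>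
        d (\<alpha> (v l) (\<alpha> b x)) (\<alpha> (a l) x) \<le> \<epsilon>) \<longrightarrow>
     (\<exists>(l::nat) l'. l < l' \<and> l' \<le> J \<and> v l = v l')"
      by (rule exI[of _ "card UU"], intro allI impI, rule main)
  qed
qed

text \<open>
  With \<open>g\<^sup>l p\<close> and \<open>g\<^sup>l q\<close> close to \<open>k h\<^sub>l x\<close> and \<open>k h'\<^sub>l x\<close>, the elements
  \<open>h\<^sub>l\<^sup>-\<^sup>1 k\<^sup>-\<^sup>1 g\<^sup>l k h\<^sub>0\<close> are confined to a finite set by acylindricity, so two of them coincide.
\<close>

theorem power_in_conjugate:
  assumes g: "g \<in> carrier G"
    and short: "\<And>K::nat. \<exists>(n::nat) m. (x, \<alpha> (g [^] n) x) \<in> cone_step ^^ m \<and>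
      K * m < d x (\<alpha> (g [^] n) x)"
  shows "\<exists>m>0. \<exists>k\<in>carrier G. \<exists>h\<in>H. g [^] (m::nat) = k \<otimes> h \<otimes> inv k"
proof -
  obtain D where D: "\<And>J R T. \<exists>n::nat. \<exists>k\<in>carrier G. \<exists>p\<in>V. \<exists>q\<in>V. d p q = R \<and>
    (\<forall>w\<in>{p, q}. T \<le> d x w \<and> T \<le> d w (\<alpha> (g [^] n) x) \<and>
       d x w + d w (\<alpha> (g [^] n) x) = d x (\<alpha> (g [^] n) x) \<and>
       (\<forall>l\<le>J. \<exists>h\<in>H. d (\<alpha> (g [^] (l::nat)) w) (\<alpha> k (\<alpha> h x)) \<le> D))"
    using coset_follows_orbit[OF g short] by blast
  obtain R0 where R0: "\<And>R1. \<exists>J. \<forall>v b a. b \<in> H \<longrightarrow> R0 \<le> d x (\<alpha> b x) \<longrightarrow> d x (\<alpha> b x) \<le> R1 \<longrightarrow>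
     (\<forall>l\<le>J. v l \<in> carrier G \<and> a l \<in> H \<and> d x (\<alpha> (a l) x) \<le> R1 \<and> d x (\<alpha> (v l) x) \<le> 2 * D \<and>
        d (\<alpha> (v l) (\<alpha> b x)) (\<alpha> (a l) x) \<le> 2 * D) \<longrightarrow>
     (\<exists>(l::nat) l'. l < l' \<and> l' \<le> J \<and> v l = v l')"
    using coset_pigeonhole[of "2 * D"] by blast
  \<comment> \<open>The piece will have length \<open>R0 + 2 * D\<close>; replacing both ends by
    points of \<open>k H x\<close> within \<open>D\<close> keeps the length between
    \<open>R0\<close> and \<open>R0 + 4 * D\<close>.\<close>
  obtain J where J: "\<And>v b a. b \<in> H \<Longrightarrow> R0 \<le> d x (\<alpha> b x) \<Longrightarrow> d x (\<alpha> b x) \<le> R0 + 4 * D \<Longrightarrow>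
     (\<And>l. l \<le> J \<Longrightarrow> v l \<in> carrier G \<and> a l \<in> H \<and> d x (\<alpha> (a l) x) \<le> R0 + 4 * D \<and>
        d x (\<alpha> (v l) x) \<le> 2 * D \<and> d (\<alpha> (v l) (\<alpha> b x)) (\<alpha> (a l) x) \<le> 2 * D) \<Longrightarrow>
     \<exists>(l::nat) l'. l < l' \<and> l' \<le> J \<and> v l = v l'"
    using R0[of "R0 + 4 * D"] by metis
  obtain k p q where k: "k \<in> carrier G" and pq: "p \<in> V" "q \<in> V" "d p q = R0 + 2 * D"
    and near: "\<forall>w\<in>{p, q}. \<forall>l\<le>J. \<exists>h\<in>H. d (\<alpha> (g [^] (l::nat)) w) (\<alpha> k (\<alpha> h x)) \<le> D"
    using D[of "R0 + 2 * D" 0 J] by blast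
  obtain h where h: "\<And>l. l \<le> J \<Longrightarrow> h l \<in> H" "\<And>l. l \<le> J \<Longrightarrow> d (\<alpha> (g [^] l) p) (\<alpha> k (\<alpha> (h l) x)) \<le> D"
    using near by (metis insertI1)
  obtain h' where h': "\<And>l. l \<le> J \<Longrightarrow> h' l \<in> H" "\<And>l. l \<le> J \<Longrightarrow> d (\<alpha> (g [^] l) q) (\<alpha> k (\<alpha> (h' l) x)) \<le> D"
    using near by (metis insertI1 insertI2)
  \<comment> \<open>\<open>v l\<close> is \<open>g^l\<close> read with origin
    \<open>k (h 0) x\<close> before and \<open>k (h l) x\<close> after; it carries \<open>x\<close>
    and \<open>a 0 x\<close> to within \<open>2 * D\<close> of \<open>x\<close> and
    \<open>a l x\<close>.\<close>
  define a where "a l = inv (h l) \<otimes> h' l" for l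
  define v where "v l = inv (h l) \<otimes> (inv k \<otimes> (g [^] l \<otimes> (k \<otimes> h 0)))" for l :: nat
  have hc [simp]: "h l \<in> carrier G" "h' l \<in> carrier G" if "l \<le> J" for l
    using h h' that by simp_all
  have aH: "a l \<in> H" if "l \<le> J" for l
    using h h' that subgroup_H unfolding a_def by (simp add: subgroup.m_closed subgroup.m_inv_closed)
  have da: "R0 \<le> d x (\<alpha> (a l) x)" "d x (\<alpha> (a l) x) \<le> R0 + 4 * D" if l: "l \<le> J" for l
  proof -
    have P: "\<alpha> (g [^] l) p \<in> V" "\<alpha> (g [^] l) q \<in> V" "\<alpha> k (\<alpha> (h l) x) \<in> V" "\<alpha> k (\<alpha> (h' l) x) \<in> V"
      using g k pq l by simp_all
    have "d x (\<alpha> (a l) x) = d (\<alpha> k (\<alpha> (h l) x)) (\<alpha> k (\<alpha> (h' l) x))"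
      using k l unfolding a_def by (simp add: act_mult dist_act_inv)
    moreover have "d (\<alpha> (g [^] l) p) (\<alpha> (g [^] l) q) = R0 + 2 * D" using pq g by simp
    ultimately show "R0 \<le> d x (\<alpha> (a l) x)" "d x (\<alpha> (a l) x) \<le> R0 + 4 * D"
      using h(2)[OF l] h'(2)[OF l] dist_triangle[OF P(1,3,2)] dist_triangle[OF P(3,4,2)]
        dist_triangle[OF P(3,1,4)] dist_triangle[OF P(1,2,4)] dist_sym[OF P(1,3)] dist_sym[OF P(2,4)]
      by linarith+
  qed
  have transport: "d (\<alpha> (g [^] l) (\<alpha> k z)) (\<alpha> k z') \<le> 2 * D"
    if "w \<in> V" "z \<in> V" "z' \<in> V" "d (\<alpha> (g [^] (0::nat)) w) (\<alpha> k z) \<le> D"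
      "d (\<alpha> (g [^] l) w) (\<alpha> k z') \<le> D" for w z z' and l :: nat
    using that g k dist_triangle[of "\<alpha> (g [^] l) (\<alpha> k z)" "\<alpha> (g [^] l) w" "\<alpha> k z'"]
      dist_sym[of w "\<alpha> k z"] by simp
  have "\<exists>l l'. l < l' \<and> l' \<le> J \<and> v l = v l'"
  proof (rule J[of "a 0" v a])
    fix l assume l: "l \<le> J"
    have "d x (\<alpha> (v l) x) = d (\<alpha> k (\<alpha> (h l) x)) (\<alpha> (g [^] l) (\<alpha> k (\<alpha> (h 0) x)))"
      using g k l unfolding v_def by (simp add: act_mult dist_act_inv)
    also have "\<dots> = d (\<alpha> (g [^] l) (\<alpha> k (\<alpha> (h 0) x))) (\<alpha> k (\<alpha> (h l) x))"
      by (rule dist_sym) (use g k l in simp_all)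
    also have "\<dots> \<le> 2 * D"
      by (rule transport[OF pq(1)]) (use h(2)[of 0] h(2)[of l] l pq in simp_all)
    finally have 1: "d x (\<alpha> (v l) x) \<le> 2 * D" .
    have "d (\<alpha> (v l) (\<alpha> (a 0) x)) (\<alpha> (a l) x) =
        d (\<alpha> (inv k) (\<alpha> (g [^] l) (\<alpha> k (\<alpha> (h' 0) x)))) (\<alpha> (h' l) x)"
      using g k l unfolding v_def a_def by (simp add: act_mult)
    also have "\<dots> = d (\<alpha> (h' l) x) (\<alpha> (inv k) (\<alpha> (g [^] l) (\<alpha> k (\<alpha> (h' 0) x))))"
      by (rule dist_sym) (use g k l in simp_all)
    also have "\<dots> = d (\<alpha> k (\<alpha> (h' l) x)) (\<alpha> (g [^] l) (\<alpha> k (\<alpha> (h' 0) x)))"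
      using g k l by (simp add: dist_act_inv)
    also have "\<dots> = d (\<alpha> (g [^] l) (\<alpha> k (\<alpha> (h' 0) x))) (\<alpha> k (\<alpha> (h' l) x))"
      by (rule dist_sym) (use g k l in simp_all)
    also have "\<dots> \<le> 2 * D"
      by (rule transport[OF pq(2)]) (use h'(2)[of 0] h'(2)[of l] l pq in simp_all)
    finally show "v l \<in> carrier G \<and> a l \<in> H \<and> d x (\<alpha> (a l) x) \<le> R0 + 4 * D \<and>
        d x (\<alpha> (v l) x) \<le> 2 * D \<and> d (\<alpha> (v l) (\<alpha> (a 0) x)) (\<alpha> (a l) x) \<le> 2 * D"
      using 1 da[OF l] aH[OF l] g k l by (simp add: v_def)
  qed (use aH da in simp_all)
  then obtain l l' where l: "l < l'" "l' \<le> J" and eq: "v l = v l'" by blast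
  define m where "m = l' - l"
  define hh where "hh = h l' \<otimes> inv (h l)"
  \<comment> \<open>Cancelling \<open>k \<otimes> h 0\<close> and then \<open>g^l\<close> on the
    right gives \<open>g^m = k (h l') (h l)^-1 k^-1\<close>.\<close>
  have "inv (h l) \<otimes> inv k \<otimes> g [^] l \<otimes> (k \<otimes> h 0) = inv (h l') \<otimes> inv k \<otimes> g [^] l' \<otimes> (k \<otimes> h 0)"
    using eq g k l unfolding v_def by (simp add: m_assoc)
  then have "inv (h l) \<otimes> inv k \<otimes> g [^] l = inv (h l') \<otimes> inv k \<otimes> g [^] l'"
    using g k l by simp
  also have "g [^] l' = g [^] m \<otimes> g [^] l"
    using g l by (simp add: nat_pow_mult m_def)
  also have "inv (h l') \<otimes> inv k \<otimes> (g [^] m \<otimes> g [^] l) = inv (h l') \<otimes> inv k \<otimes> g [^] m \<otimes> g [^] l"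
    using g k l by (simp add: m_assoc)
  finally have "inv (h l) \<otimes> inv k = inv (h l') \<otimes> inv k \<otimes> g [^] m"
    using g k l by simp
  then have "inv (h l) \<otimes> inv k = inv (h l') \<otimes> (inv k \<otimes> g [^] m)"
    using g k l by (simp add: m_assoc)
  then have "h l' \<otimes> (inv (h l) \<otimes> inv k) = inv k \<otimes> g [^] m"
    using g k l by (simp flip: m_assoc)
  then have "k \<otimes> (h l' \<otimes> (inv (h l) \<otimes> inv k)) = g [^] m"
    using g k by (simp flip: m_assoc)
  then have "g [^] m = k \<otimes> hh \<otimes> inv k"
    using k l unfolding hh_def by (simp add: m_assoc)
  moreover have "hh \<in> H"
    using h(1) l subgroup_H unfolding hh_def by (simp add: subgroup.m_closed subgroup.m_inv_closed)
  ultimately show ?thesis using k l by (intro exI[of _ m]) (auto simp: m_def)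
qed

text \<open>
  If no power of \<open>g\<close> drifts, then powers of \<open>g\<close> barely move the points in the middle of
  \<open>[x, g\<^sup>n x]\<close>, so acylindricity leaves only finitely many of them.
\<close>

theorem torsion_if_no_drift:
  assumes g: "g \<in> carrier G"
    and short: "\<And>K::nat. \<exists>(n::nat) m. (x, \<alpha> (g [^] n) x) \<in> cone_step ^^ m \<and>
      K * m < d x (\<alpha> (g [^] n) x)"
    and no_drift: "\<And>(l::nat) p. p \<in> V \<Longrightarrow>
      d p (\<alpha> (g [^] l) (\<alpha> (g [^] l) p)) \<le> d p (\<alpha> (g [^] l) p) + \<delta>"
  shows "\<exists>m>0. g [^] (m::nat) = \<one>"
proof -
  obtain D where D: "\<And>J R T. \<exists>n::nat. \<exists>k\<in>carrier G. \<exists>p\<in>V. \<exists>q\<in>V. d p q = R \<and>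
    (\<forall>w\<in>{p, q}. T \<le> d x w \<and> T \<le> d w (\<alpha> (g [^] n) x) \<and>
       d x w + d w (\<alpha> (g [^] n) x) = d x (\<alpha> (g [^] n) x) \<and>
       (\<forall>l\<le>J. \<exists>h\<in>H. d (\<alpha> (g [^] (l::nat)) w) (\<alpha> k (\<alpha> h x)) \<le> D))"
    using coset_follows_orbit[OF g short] by blast
  \<comment> \<open>Passing from a point of \<open>k H x\<close> to the nearby \<open>p\<close> or
    \<open>q\<close> and back costs \<open>2 * D\<close>; \<open>4 * \<delta>\<close> is the
    displacement of \<open>p\<close> and \<open>q\<close> themselves.\<close>
  define \<epsilon> where "\<epsilon> = 2 * D + 4 * \<delta>"
  obtain R0 where R0: "\<And>R1. \<exists>J. \<forall>v b a. b \<in> H \<longrightarrow> R0 \<le> d x (\<alpha> b x) \<longrightarrow> d x (\<alpha> b x) \<le> R1 \<longrightarrow>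
     (\<forall>l\<le>J. v l \<in> carrier G \<and> a l \<in> H \<and> d x (\<alpha> (a l) x) \<le> R1 \<and> d x (\<alpha> (v l) x) \<le> \<epsilon> \<and>
        d (\<alpha> (v l) (\<alpha> b x)) (\<alpha> (a l) x) \<le> \<epsilon>) \<longrightarrow>
     (\<exists>(l::nat) l'. l < l' \<and> l' \<le> J \<and> v l = v l')"
    using coset_pigeonhole[of \<epsilon>] by blast
  obtain J where J: "\<And>v b a. b \<in> H \<Longrightarrow> R0 \<le> d x (\<alpha> b x) \<Longrightarrow> d x (\<alpha> b x) \<le> R0 + 4 * D \<Longrightarrow>
     (\<And>l. l \<le> J \<Longrightarrow> v l \<in> carrier G \<and> a l \<in> H \<and> d x (\<alpha> (a l) x) \<le> R0 + 4 * D \<and>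
        d x (\<alpha> (v l) x) \<le> \<epsilon> \<and> d (\<alpha> (v l) (\<alpha> b x)) (\<alpha> (a l) x) \<le> \<epsilon>) \<Longrightarrow>
     \<exists>(l::nat) l'. l < l' \<and> l' \<le> J \<and> v l = v l'"
    using R0[of "R0 + 4 * D"] by metis
  define T0 where "T0 = (\<Sum>l\<le>J. d x (\<alpha> (g [^] (l::nat)) x))"
  \<comment> \<open>Depth \<open>T0 + \<delta> + 1\<close> gives the strict inequalities of
    \<open>displacement_le_of_no_drift\<close> for \<open>t = T0\<close>.\<close>
  obtain n :: nat and k p q where k: "k \<in> carrier G" and pq: "p \<in> V" "q \<in> V" "d p q = R0 + 2 * D"
    and deep: "\<forall>w\<in>{p, q}. T0 + \<delta> + 1 \<le> d x w \<and> T0 + \<delta> + 1 \<le> d w (\<alpha> (g [^] n) x) \<and>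
       d x w + d w (\<alpha> (g [^] n) x) = d x (\<alpha> (g [^] n) x)"
    and near: "\<forall>w\<in>{p, q}. \<forall>l\<le>J. \<exists>h\<in>H. d (\<alpha> (g [^] (l::nat)) w) (\<alpha> k (\<alpha> h x)) \<le> D"
    using D[of "R0 + 2 * D" "T0 + \<delta> + 1" J] by blast
  obtain h where h: "h \<in> H" "d p (\<alpha> k (\<alpha> h x)) \<le> D"
    using near[rule_format, of p 0] pq by auto
  obtain h' where h': "h' \<in> H" "d q (\<alpha> k (\<alpha> h' x)) \<le> D"
    using near[rule_format, of q 0] pq by auto
  have hc [simp]: "h \<in> carrier G" "h' \<in> carrier G" using h h' by simp_all
  have small: "d w (\<alpha> (g [^] l) w) \<le> 4 * \<delta>" if w: "w \<in> {p, q}" and l: "l \<le> J" for w and l :: nat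
  proof -
    define y where "y = \<alpha> (g [^] n) x"
    define f where "f = \<alpha> (g [^] l)"
    have V: "x \<in> V" "y \<in> V" "w \<in> V" "f x \<in> V" "f y \<in> V" "f w \<in> V" "f (f w) \<in> V"
      using g w pq by (auto simp: y_def f_def)
    have fd: "d (f u) (f u') = d u u'" if "u \<in> V" "u' \<in> V" for u u'
      using that g by (simp add: f_def)
    have t: "d x (f x) \<le> T0"
      unfolding T0_def f_def using l by (intro member_le_sum) auto
    have "d y (f y) = d x (f x)"
      using g unfolding y_def f_def by (simp add: act_pow_commute[of g x l n])
    with t have t': "d y (f y) \<le> T0" by simp
    have "d w (f w) \<le> 4 * \<delta>"
      by (rule displacement_le_of_no_drift[OF V _ _ _ _ _ _ t t'])
        (use V fd deep w no_drift[of w l] in \<open>auto simp: y_def f_def\<close>)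
    then show ?thesis by (simp add: f_def)
  qed
  have transport: "d (\<alpha> k z) (\<alpha> (g [^] l) (\<alpha> k z)) \<le> \<epsilon>"
    if "w \<in> {p, q}" "z \<in> V" "d w (\<alpha> k z) \<le> D" "l \<le> J" for w z and l :: nat
  proof -
    have V: "w \<in> V" "\<alpha> k z \<in> V" "\<alpha> (g [^] l) (\<alpha> k z) \<in> V" "\<alpha> (g [^] l) w \<in> V"
      using that pq g k by auto
    have "d (\<alpha> (g [^] l) w) (\<alpha> (g [^] l) (\<alpha> k z)) = d w (\<alpha> k z)" using V g by simp
    then show ?thesis
      using that small[of w l] dist_triangle[OF V(2,1,3)] dist_triangle[OF V(1,4,3)] dist_sym[OF V(1,2)]
      unfolding \<epsilon>_def by linarith
  qed
  \<comment> \<open>One pair \<open>h\<close>, \<open>h'\<close> serves every \<open>l\<close>,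
    since \<open>g^l\<close> hardly moves \<open>p\<close> and \<open>q\<close>. So
    \<open>v l\<close> is a conjugate of \<open>g^l\<close> by a fixed element, and a coincidence is
    an equality of powers of \<open>g\<close>, not merely one modulo \<open>H\<close>.\<close>
  define b where "b = inv h \<otimes> h'"
  define v where "v l = inv h \<otimes> (inv k \<otimes> (g [^] l \<otimes> (k \<otimes> h)))" for l :: nat
  have bH: "b \<in> H"
    using h h' subgroup_H unfolding b_def by (simp add: subgroup.m_closed subgroup.m_inv_closed)
  have db: "R0 \<le> d x (\<alpha> b x)" "d x (\<alpha> b x) \<le> R0 + 4 * D"
  proof -
    have P: "p \<in> V" "q \<in> V" "\<alpha> k (\<alpha> h x) \<in> V" "\<alpha> k (\<alpha> h' x) \<in> V"
      using k pq by simp_all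
    have "d x (\<alpha> b x) = d (\<alpha> k (\<alpha> h x)) (\<alpha> k (\<alpha> h' x))"
      using k unfolding b_def by (simp add: act_mult dist_act_inv)
    then show "R0 \<le> d x (\<alpha> b x)" "d x (\<alpha> b x) \<le> R0 + 4 * D"
      using h(2) h'(2) pq(3) dist_triangle[OF P(1,3,2)] dist_triangle[OF P(3,4,2)]
        dist_triangle[OF P(3,1,4)] dist_triangle[OF P(1,2,4)] dist_sym[OF P(1,3)] dist_sym[OF P(2,4)]
      by linarith+
  qed
  have "\<exists>l l'. l < l' \<and> l' \<le> J \<and> v l = v l'"
  proof (rule J[of b v "\<lambda>_. b"])
    fix l assume l: "l \<le> J"
    have "d x (\<alpha> (v l) x) = d (\<alpha> k (\<alpha> h x)) (\<alpha> (g [^] l) (\<alpha> k (\<alpha> h x)))"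
      using g k unfolding v_def by (simp add: act_mult dist_act_inv)
    also have "\<dots> \<le> \<epsilon>" by (rule transport[of p]) (use h l in simp_all)
    finally have 1: "d x (\<alpha> (v l) x) \<le> \<epsilon>" .
    have "d (\<alpha> (v l) (\<alpha> b x)) (\<alpha> b x) =
        d (\<alpha> (inv k) (\<alpha> (g [^] l) (\<alpha> k (\<alpha> h' x)))) (\<alpha> h' x)"
      using g k unfolding v_def b_def by (simp add: act_mult)
    also have "\<dots> = d (\<alpha> h' x) (\<alpha> (inv k) (\<alpha> (g [^] l) (\<alpha> k (\<alpha> h' x))))"
      by (rule dist_sym) (use g k in simp_all)
    also have "\<dots> = d (\<alpha> k (\<alpha> h' x)) (\<alpha> (g [^] l) (\<alpha> k (\<alpha> h' x)))"
      using g k by (simp add: dist_act_inv)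
    also have "\<dots> \<le> \<epsilon>" by (rule transport[of q]) (use h' l in simp_all)
    finally show "v l \<in> carrier G \<and> b \<in> H \<and> d x (\<alpha> b x) \<le> R0 + 4 * D \<and>
        d x (\<alpha> (v l) x) \<le> \<epsilon> \<and> d (\<alpha> (v l) (\<alpha> b x)) (\<alpha> b x) \<le> \<epsilon>"
      using 1 db bH g k by (simp add: v_def)
  qed (use bH db in simp_all)
  then obtain l l' where l: "l < l'" "l' \<le> J" and eq: "v l = v l'" by blast
  have "g [^] l = g [^] l'"
    using eq g k unfolding v_def by simp
  also have "g [^] l' = g [^] (l' - l) \<otimes> g [^] l"
    using g l by (simp add: nat_pow_mult)
  finally have "g [^] (l' - l) = \<one>"
    using g by (metis nat_pow_closed r_cancel_one')
  then show ?thesis using l by (intro exI[of _ "l' - l"]) simp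
qed

end

section \<open>The metric realization of a graph\<close>

text \<open>Turns concatenation, reversal and splitting of walks into algebra of relations. The
  zeroth relational power relates every element to itself, so the vertex condition has to be
  stated.\<close>

lemma (in wf_digraph) awalk_iff_relpow:
  "(\<exists>p. awalk u p v \<and> length p = n) \<longleftrightarrow> u \<in> verts G \<and> (u, v) \<in> arcs_ends G ^^ n"
proof (induction n arbitrary: u)
  case 0
  then show ?case by (auto simp: awalk_Nil_iff)
next
  case (Suc n)
  have "(\<exists>p. awalk u p v \<and> length p = Suc n) \<longleftrightarrow>
      (\<exists>e\<in>arcs G. tail G e = u \<and> (\<exists>p. awalk (head G e) p v \<and> length p = n))"
  proof (intro iffI; elim exE bexE conjE)
    fix p assume "awalk u p v" "length p = Suc n"
    then show "\<exists>e\<in>arcs G. tail G e = u \<and> (\<exists>p. awalk (head G e) p v \<and> length p = n)"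
      by (cases p) (auto simp: awalk_Cons_iff)
  next
    fix e p assume "e \<in> arcs G" "tail G e = u" "awalk (head G e) p v" "length p = n"
    then show "\<exists>p. awalk u p v \<and> length p = Suc n"
      by (intro exI[of _ "e # p"]) (simp add: awalk_Cons_iff)
  qed
  also have "\<dots> \<longleftrightarrow> (\<exists>e\<in>arcs G. tail G e = u \<and> (head G e, v) \<in> arcs_ends G ^^ n)"
    using Suc.IH by auto
  also have "\<dots> \<longleftrightarrow> u \<in> verts G \<and> (u, v) \<in> arcs_ends G ^^ Suc n"
  proof
    assume "\<exists>e\<in>arcs G. tail G e = u \<and> (head G e, v) \<in> arcs_ends G ^^ n"
    then obtain e where e: "e \<in> arcs G" "tail G e = u" "(head G e, v) \<in> arcs_ends G ^^ n" by blast
    then have "(u, head G e) \<in> arcs_ends G" by (auto intro: in_arcs_imp_in_arcs_ends)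
    then show "u \<in> verts G \<and> (u, v) \<in> arcs_ends G ^^ Suc n"
      using e relpow_Suc_I2 tail_in_verts by metis
  next
    assume "u \<in> verts G \<and> (u, v) \<in> arcs_ends G ^^ Suc n"
    then obtain w where "(u, w) \<in> arcs_ends G" "(w, v) \<in> arcs_ends G ^^ n"
      by (meson relpow_Suc_D2)
    then show "\<exists>e\<in>arcs G. tail G e = u \<and> (head G e, v) \<in> arcs_ends G ^^ n"
      by (auto simp: arcs_ends_def arc_to_ends_def)
  qed
  finally show ?case .
qed

locale connected_bidirected_graph = bidirected_digraph X \<iota>
  for X :: "('v, 'e) pre_digraph" and \<iota> +
  assumes connected: "strongly_connected X"
begin

lemma vertex_dist_eq_Least:
  "u \<in> verts X \<Longrightarrow> vertex_dist X u v = (LEAST n. (u, v) \<in> arcs_ends X ^^ n)"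
  unfolding vertex_dist_def awalk_iff_relpow by simp

lemma relpow_vertex_dist:
  assumes "u \<in> verts X" "v \<in> verts X"
  shows "(u, v) \<in> arcs_ends X ^^ vertex_dist X u v"
proof -
  have "(u, v) \<in> rtrancl_on (verts X) (arcs_ends X)"
    using connected assms by (auto simp: strongly_connected_def reachable_def)
  then have "(u, v) \<in> (arcs_ends X)\<^sup>*"
    by (induction rule: rtrancl_on_induct) auto
  then have "\<exists>n. (u, v) \<in> arcs_ends X ^^ n" by (rule rtrancl_imp_relpow)
  then show ?thesis unfolding vertex_dist_eq_Least[OF assms(1)] by (rule LeastI_ex)
qed

lemma vertex_dist_le:
  "u \<in> verts X \<Longrightarrow> (u, v) \<in> arcs_ends X ^^ n \<Longrightarrow> vertex_dist X u v \<le> n"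
  by (simp add: vertex_dist_eq_Least Least_le)

lemma relpow_in_verts: "(u, v) \<in> arcs_ends X ^^ n \<Longrightarrow> u \<in> verts X \<Longrightarrow> v \<in> verts X"
  by (induction n arbitrary: v) (auto dest: adj_in_verts)

lemma relpow_sym: "(u, v) \<in> arcs_ends X ^^ n \<Longrightarrow> (v, u) \<in> arcs_ends X ^^ n"
proof (induction n arbitrary: v)
  case (Suc n)
  then obtain w where w: "(u, w) \<in> arcs_ends X ^^ n" "(w, v) \<in> arcs_ends X" by auto
  have "(v, w) \<in> arcs_ends X"
    using w(2) sym_arcs by (auto simp: symmetric_def dest: symD)
  then show ?case using Suc.IH[OF w(1)] by (rule relpow_Suc_I2)
qed simp

lemma vertex_dist_zero:
  assumes "u \<in> verts X" "v \<in> verts X"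
  shows "vertex_dist X u v = 0 \<longleftrightarrow> u = v"
  using relpow_vertex_dist[OF assms] vertex_dist_le[OF assms(1), of u 0] by auto

lemma vertex_dist_sym:
  "u \<in> verts X \<Longrightarrow> v \<in> verts X \<Longrightarrow> vertex_dist X u v = vertex_dist X v u"
  by (simp add: antisym vertex_dist_le relpow_sym relpow_vertex_dist)

lemma vertex_dist_triangle:
  assumes "u \<in> verts X" "v \<in> verts X" "w \<in> verts X"
  shows "vertex_dist X u w \<le> vertex_dist X u v + vertex_dist X v w"
  by (intro vertex_dist_le relpow_trans[of _ v] relpow_vertex_dist assms)

lemma vertex_dist_arc: "e \<in> arcs X \<Longrightarrow> vertex_dist X (tail X e) (head X e) \<le> 1"
  by (rule vertex_dist_le) (auto dest: in_arcs_imp_in_arcs_ends)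

lemma vertex_dist_interval:
  assumes "u \<in> verts X" "v \<in> verts X" "s \<le> vertex_dist X u v"
  shows "\<exists>w\<in>verts X. vertex_dist X u w = s \<and> s + vertex_dist X w v = vertex_dist X u v"
proof -
  have "(u, v) \<in> arcs_ends X ^^ (s + (vertex_dist X u v - s))"
    using relpow_vertex_dist assms by simp
  then obtain w where w: "(u, w) \<in> arcs_ends X ^^ s" "(w, v) \<in> arcs_ends X ^^ (vertex_dist X u v - s)"
    unfolding relpow_add by blast
  have "w \<in> verts X" using relpow_in_verts w(1) assms(1) by blast
  moreover have "vertex_dist X u w \<le> s" "vertex_dist X w v \<le> vertex_dist X u v - s"
    using vertex_dist_le w assms \<open>w \<in> verts X\<close> by blast+
  ultimately show ?thesis
    using vertex_dist_triangle[of u w v] assms by (intro bexI[of _ w]) auto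
qed

text \<open>The candidates whose minimum is \<open>graph_dist\<close>; the metric axioms are checked
  on candidates before any minimum is taken.\<close>

definition lengths :: "('v, 'e) graph_point \<Rightarrow> ('v, 'e) graph_point \<Rightarrow> real set" where
  "lengths p q = direct_lengths p q \<union> {s + real (vertex_dist X u v) + t | u s v t.
     (u, s) \<in> endpoints X p \<and> (v, t) \<in> endpoints X q}"

lemma realization_cases [consumes 1, case_names vertex inner]:
  assumes "p \<in> realization X \<iota>"
  obtains v where "p = Inl v" "v \<in> verts X"
  | e t where "p = Inr {(e, t), (\<iota> e, 1 - t)}" "e \<in> arcs X" "0 < t" "t < 1"
  using assms unfolding realization_def by blast

lemma Inl_in_realization [simp]: "Inl v \<in> realization X \<iota> \<longleftrightarrow> v \<in> verts X"
  by (auto simp: realization_def)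

lemma endpoints_props:
  assumes "p \<in> realization X \<iota>" "(u, s) \<in> endpoints X p"
  shows "u \<in> verts X" "0 \<le> s" "s \<le> 1"
  using assms by (auto elim!: realization_cases)

lemma endpoints_nonempty: "p \<in> realization X \<iota> \<Longrightarrow> endpoints X p \<noteq> {}"
  by (auto elim!: realization_cases)

lemma finite_endpoints: "p \<in> realization X \<iota> \<Longrightarrow> finite (endpoints X p)"
  by (auto elim!: realization_cases)

text \<open>The two parameters of an inner point add up to one, the length of its edge. This closes
  the gap when two paths meet at an inner point but use different endpoints of its edge.\<close>

lemma endpoints_dist:
  assumes "p \<in> realization X \<iota>" "(u, s) \<in> endpoints X p" "(v, t) \<in> endpoints X p"
  shows "real (vertex_dist X u v) \<le> s + t"
  using assms(1)
proof (cases rule: realization_cases)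
  case (inner e r)
  have "vertex_dist X (tail X e) (head X e) \<le> 1" "vertex_dist X (head X e) (tail X e) \<le> 1"
    using vertex_dist_arc[of e] inner vertex_dist_sym[of "tail X e" "head X e"] by auto
  moreover have "vertex_dist X (tail X e) (tail X e) = 0" "vertex_dist X (head X e) (head X e) = 0"
    using inner by (simp_all add: vertex_dist_zero)
  ultimately show ?thesis using assms(2,3) inner by auto
qed (use assms in \<open>auto simp: vertex_dist_zero\<close>)

lemma finite_lengths:
  assumes "p \<in> realization X \<iota>" "q \<in> realization X \<iota>"
  shows "finite (lengths p q)"
proof -
  have "finite (direct_lengths p q)"
  proof (cases "\<exists>P Q. p = Inr P \<and> q = Inr Q")
    case True
    then obtain P Q where PQ: "p = Inr P" "q = Inr Q" by blast
    have "finite P" "finite Q" using assms PQ by (auto simp: realization_def)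
    moreover have "direct_lengths p q \<subseteq> (\<lambda>((e, s), (e', t)). \<bar>s - t\<bar>) ` (P \<times> Q)"
      unfolding PQ by (auto intro!: rev_image_eqI)
    ultimately show ?thesis by (meson finite_SigmaI finite_imageI finite_subset)
  next
    case False
    then show ?thesis by (cases p; cases q) auto
  qed
  moreover have "{s + real (vertex_dist X u v) + t | u s v t.
     (u, s) \<in> endpoints X p \<and> (v, t) \<in> endpoints X q} \<subseteq>
     (\<lambda>((u, s), (v, t)). s + real (vertex_dist X u v) + t) ` (endpoints X p \<times> endpoints X q)"
    by (auto intro!: rev_image_eqI)
  then have "finite {s + real (vertex_dist X u v) + t | u s v t.
     (u, s) \<in> endpoints X p \<and> (v, t) \<in> endpoints X q}"
    using assms by (meson finite_SigmaI finite_imageI finite_subset finite_endpoints)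
  ultimately show ?thesis by (simp add: lengths_def)
qed

lemma lengths_nonempty:
  assumes "p \<in> realization X \<iota>" "q \<in> realization X \<iota>"
  shows "lengths p q \<noteq> {}"
  using endpoints_nonempty[OF assms(1)] endpoints_nonempty[OF assms(2)] unfolding lengths_def by fast

lemma graph_dist_eq_Min:
  assumes "p \<in> realization X \<iota>" "q \<in> realization X \<iota>"
  shows "graph_dist X \<iota> p q = Min (lengths p q)"
  using assms by (simp add: graph_dist_def lengths_def)

lemma graph_dist_le:
  assumes "p \<in> realization X \<iota>" "q \<in> realization X \<iota>" "r \<in> lengths p q"
  shows "graph_dist X \<iota> p q \<le> r"
  using assms by (simp add: graph_dist_eq_Min finite_lengths)

lemma graph_dist_in_lengths:
  assumes "p \<in> realization X \<iota>" "q \<in> realization X \<iota>"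
  shows "graph_dist X \<iota> p q \<in> lengths p q"
  using assms by (simp add: graph_dist_eq_Min finite_lengths lengths_nonempty)

lemma direct_lengths_sym: "direct_lengths p q = direct_lengths q p"
  by (cases p; cases q) (auto, metis abs_minus_commute, metis abs_minus_commute)

lemma lengths_sym:
  assumes "p \<in> realization X \<iota>" "q \<in> realization X \<iota>"
  shows "lengths p q = lengths q p"
proof -
  have "lengths p q \<subseteq> lengths q p"
    if "p \<in> realization X \<iota>" "q \<in> realization X \<iota>" for p q
  proof -
    have "s + real (vertex_dist X u v) + t = t + real (vertex_dist X v u) + s"
      if "(u, s) \<in> endpoints X p" "(v, t) \<in> endpoints X q" for u s v t
      using endpoints_props that \<open>p \<in> realization X \<iota>\<close> \<open>q \<in> realization X \<iota>\<close>
        vertex_dist_sym[of u v] by auto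
    then show ?thesis unfolding lengths_def direct_lengths_sym[of p q] by blast
  qed
  then show ?thesis using assms by blast
qed

lemma inner_point_eq:
  assumes "Inr P \<in> realization X \<iota>" "(e, s) \<in> P"
  shows "P = {(e, s), (\<iota> e, 1 - s)}"
proof -
  obtain a r where a: "P = {(a, r), (\<iota> a, 1 - r)}"
    using assms by (auto simp: realization_def)
  then consider "e = a" "s = r" | "e = \<iota> a" "s = 1 - r" using assms(2) by blast
  then show ?thesis by cases (simp_all add: a insert_commute)
qed

text \<open>Reversing the edge replaces both parameters by their complements to one, which keeps the
  difference.\<close>

lemma inner_param_transfer:
  assumes P: "Inr P \<in> realization X \<iota>" and Q: "Inr Q \<in> realization X \<iota>"
    and es: "(e, s) \<in> P" and et: "(e, t) \<in> Q" and "(e', t') \<in> Q"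
  obtains s' where "(e', s') \<in> P" "\<bar>s' - t'\<bar> = \<bar>s - t\<bar>"
proof -
  consider "e' = e" "t' = t" | "e' = \<iota> e" "t' = 1 - t"
    using assms(5) inner_point_eq[OF Q et] by blast
  then show ?thesis
  proof cases
    case 2
    then show ?thesis using that[of "1 - s"] inner_point_eq[OF P es] by auto
  qed (use es that in blast)
qed

text \<open>As \<open>p\<close> and \<open>q\<close> lie on a common edge, a path from
  \<open>q\<close> can be started at \<open>p\<close> instead, at the cost of
  \<open>\<bar>s - t\<bar>\<close>.\<close>

lemma lengths_triangle_direct:
  assumes pq: "p \<in> realization X \<iota>" "q \<in> realization X \<iota>" "r \<in> realization X \<iota>"
    and a: "a \<in> direct_lengths p q" and b: "b \<in> lengths q r"
  shows "\<exists>c\<in>lengths p r. c \<le> a + b"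
proof -
  obtain P Q e s t where PQ: "p = Inr P" "q = Inr Q" and est: "(e, s) \<in> P" "(e, t) \<in> Q" "a = \<bar>s - t\<bar>"
    using a by (cases p; cases q) auto
  note transfer = inner_param_transfer[of P Q e s t]
  consider "b \<in> direct_lengths q r" | u t' v w where "b = t' + real (vertex_dist X u v) + w"
      "(u, t') \<in> endpoints X q" "(v, w) \<in> endpoints X r"
    using b unfolding lengths_def by blast
  then show ?thesis
  proof cases
    case 1
    then obtain R e' t' w where R: "r = Inr R" "(e', t') \<in> Q" "(e', w) \<in> R" "b = \<bar>t' - w\<bar>"
      using PQ by (cases r) auto
    obtain s' where "(e', s') \<in> P" "\<bar>s' - t'\<bar> = \<bar>s - t\<bar>"
      using transfer R est pq PQ by metis
    then show ?thesis using R est unfolding PQ lengths_def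
      by (intro bexI[of _ "\<bar>s' - w\<bar>"]) auto
  next
    case b: (2 u t' v w)
    then obtain e' where e': "(e', t') \<in> Q" "u = tail X e'" using PQ by auto
    obtain s' where s': "(e', s') \<in> P" "\<bar>s' - t'\<bar> = \<bar>s - t\<bar>"
      using transfer e' est pq PQ by metis
    have "(u, s') \<in> endpoints X p" using s' e' PQ by (auto intro!: rev_image_eqI)
    then have "s' + real (vertex_dist X u v) + w \<in> lengths p r"
      using b unfolding lengths_def by blast
    then show ?thesis using b s' est by (intro bexI[of _ "s' + real (vertex_dist X u v) + w"]) auto
  qed
qed

lemma lengths_triangle:
  assumes pq: "p \<in> realization X \<iota>" "q \<in> realization X \<iota>" "r \<in> realization X \<iota>"
    and a: "a \<in> lengths p q" and b: "b \<in> lengths q r"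
  shows "\<exists>c\<in>lengths p r. c \<le> a + b"
proof (cases "a \<in> direct_lengths p q \<or> b \<in> direct_lengths q r")
  case True
  then show ?thesis
  proof
    assume "b \<in> direct_lengths q r"
    then have "b \<in> direct_lengths r q" by (simp add: direct_lengths_sym)
    moreover have "a \<in> lengths q p" using a lengths_sym pq by blast
    ultimately have "\<exists>c\<in>lengths r p. c \<le> b + a" by (rule lengths_triangle_direct[OF pq(3,2,1)])
    then show ?thesis using lengths_sym pq by (simp add: add.commute)
  qed (use lengths_triangle_direct[OF pq] b in blast)
next
  case False
  then obtain u s v t where 1: "a = s + real (vertex_dist X u v) + t"
    "(u, s) \<in> endpoints X p" "(v, t) \<in> endpoints X q" using a unfolding lengths_def by blast
  obtain v' t' w m where 2: "b = t' + real (vertex_dist X v' w) + m"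
    "(v', t') \<in> endpoints X q" "(w, m) \<in> endpoints X r" using b False unfolding lengths_def by blast
  have V: "u \<in> verts X" "v \<in> verts X" "v' \<in> verts X" "w \<in> verts X"
    using endpoints_props 1 2 pq by blast+
  have "vertex_dist X u w \<le> vertex_dist X u v + vertex_dist X v v' + vertex_dist X v' w"
    using vertex_dist_triangle[OF V(1,2,4)] vertex_dist_triangle[OF V(2,3,4)] by simp
  moreover have "real (vertex_dist X v v') \<le> t + t'"
    using endpoints_dist[OF pq(2) 1(3) 2(2)] .
  ultimately have "s + real (vertex_dist X u w) + m \<le> a + b" using 1 2 by simp
  then show ?thesis using 1 2 unfolding lengths_def by blast
qed

lemma lengths_nonneg:
  assumes "p \<in> realization X \<iota>" "q \<in> realization X \<iota>" "r \<in> lengths p q"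
  shows "0 \<le> r"
proof (cases "r \<in> direct_lengths p q")
  case True
  then show ?thesis by (cases p; cases q) auto
next
  case False
  then show ?thesis using assms endpoints_props unfolding lengths_def by fastforce
qed

lemma zero_in_lengths_iff:
  assumes pq: "p \<in> realization X \<iota>" "q \<in> realization X \<iota>"
  shows "0 \<in> lengths p q \<longleftrightarrow> p = q"
proof
  assume 0: "0 \<in> lengths p q"
  show "p = q"
  proof (cases "0 \<in> direct_lengths p q")
    case True
    then obtain P Q e s where "p = Inr P" "q = Inr Q" "(e, s) \<in> P" "(e, s) \<in> Q"
      by (cases p; cases q) auto
    then show ?thesis using inner_point_eq pq by metis
  next
    case False
    then obtain u s v t where *: "(u, s) \<in> endpoints X p" "(v, t) \<in> endpoints X q"
      "0 = s + real (vertex_dist X u v) + t" using 0 unfolding lengths_def by blast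
    have "u \<in> verts X" "v \<in> verts X" "0 \<le> s" "0 \<le> t" using endpoints_props pq * by blast+
    then have st: "s = 0" "t = 0" "u = v" using *(3) vertex_dist_zero[of u v] by auto
    from pq(1) have "p = Inl u"
      by (cases rule: realization_cases) (use * st in auto)
    moreover from pq(2) have "q = Inl u"
      by (cases rule: realization_cases) (use * st in auto)
    ultimately show ?thesis by simp
  qed
next
  assume "p = q"
  with pq(1) show "0 \<in> lengths p q"
  proof (cases rule: realization_cases)
    case (vertex v)
    then show ?thesis using \<open>p = q\<close> by (auto simp: lengths_def vertex_dist_zero)
  next
    case (inner e t)
    then have "0 \<in> direct_lengths p q" using \<open>p = q\<close> by auto
    then show ?thesis by (simp add: lengths_def)
  qed
qed

lemma Metric_space_realization: "Metric_space (realization X \<iota>) (graph_dist X \<iota>)"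
proof
  show "0 \<le> graph_dist X \<iota> p q" for p q
  proof (cases "p \<in> realization X \<iota> \<and> q \<in> realization X \<iota>")
    case True
    then show ?thesis using graph_dist_in_lengths lengths_nonneg by blast
  qed (auto simp: graph_dist_def)
  show "graph_dist X \<iota> p q = graph_dist X \<iota> q p" for p q
  proof (cases "p \<in> realization X \<iota> \<and> q \<in> realization X \<iota>")
    case True
    then show ?thesis using lengths_sym[of p q] by (simp add: graph_dist_eq_Min)
  qed (auto simp: graph_dist_def)
  show "graph_dist X \<iota> p q = 0 \<longleftrightarrow> p = q" if "p \<in> realization X \<iota>" "q \<in> realization X \<iota>" for p q
  proof
    assume "graph_dist X \<iota> p q = 0"
    then show "p = q" using graph_dist_in_lengths[OF that] zero_in_lengths_iff[OF that] by simp
  next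
    assume "p = q"
    then have "graph_dist X \<iota> p q \<le> 0" using graph_dist_le[OF that] zero_in_lengths_iff[OF that] by blast
    moreover have "0 \<le> graph_dist X \<iota> p q"
      using graph_dist_in_lengths[OF that] lengths_nonneg[OF that] by blast
    ultimately show "graph_dist X \<iota> p q = 0" by simp
  qed
  show "graph_dist X \<iota> p r \<le> graph_dist X \<iota> p q + graph_dist X \<iota> q r"
    if pqr: "p \<in> realization X \<iota>" "q \<in> realization X \<iota>" "r \<in> realization X \<iota>" for p q r
  proof -
    obtain c where "c \<in> lengths p r" "c \<le> graph_dist X \<iota> p q + graph_dist X \<iota> q r"
      using lengths_triangle[OF pqr graph_dist_in_lengths[OF pqr(1,2)] graph_dist_in_lengths[OF pqr(2,3)]]
      by blast
    then show ?thesis using graph_dist_le[OF pqr(1,3)] by force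
  qed
qed

lemma graph_dist_Inl [simp]:
  assumes "u \<in> verts X" "v \<in> verts X"
  shows "graph_dist X \<iota> (Inl u) (Inl v) = vertex_dist X u v"
proof -
  have "lengths (Inl u) (Inl v) = {real (vertex_dist X u v)}" by (auto simp: lengths_def)
  then show ?thesis using assms by (simp add: graph_dist_eq_Min)
qed

end

section \<open>Actions by graph automorphisms\<close>

locale graph_automorphisms = connected_bidirected_graph X \<iota> + group G
  for X :: "('v, 'e) pre_digraph" and \<iota> and G :: "('g, 'm) monoid_scheme" (structure) +
  fixes \<alpha> :: "'g \<Rightarrow> 'v \<Rightarrow> 'v" and \<beta> :: "'g \<Rightarrow> 'e \<Rightarrow> 'e"
  assumes verts_action: "group_action G (verts X) \<alpha>"
    and arc_closed: "g \<in> carrier G \<Longrightarrow> e \<in> arcs X \<Longrightarrow> \<beta> g e \<in> arcs X"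
    and tail_act: "g \<in> carrier G \<Longrightarrow> e \<in> arcs X \<Longrightarrow> tail X (\<beta> g e) = \<alpha> g (tail X e)"
    and head_act: "g \<in> carrier G \<Longrightarrow> e \<in> arcs X \<Longrightarrow> head X (\<beta> g e) = \<alpha> g (head X e)"
    and rev_act: "g \<in> carrier G \<Longrightarrow> e \<in> arcs X \<Longrightarrow> \<beta> g (\<iota> e) = \<iota> (\<beta> g e)"
begin

lemma vert_closed [simp]: "g \<in> carrier G \<Longrightarrow> u \<in> verts X \<Longrightarrow> \<alpha> g u \<in> verts X"
  using group_action.element_image[OF verts_action] by blast

lemma vert_one [simp]: "u \<in> verts X \<Longrightarrow> \<alpha> \<one> u = u"
  using group_action.id_eq_one[OF verts_action] by (metis restrict_apply')

lemma vert_mult: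
  "g \<in> carrier G \<Longrightarrow> h \<in> carrier G \<Longrightarrow> u \<in> verts X \<Longrightarrow> \<alpha> (g \<otimes> h) u = \<alpha> g (\<alpha> h u)"
  using group_action.composition_rule[OF verts_action] by blast

lemma vertex_dist_act_le:
  assumes "g \<in> carrier G" "u \<in> verts X" "v \<in> verts X"
  shows "vertex_dist X (\<alpha> g u) (\<alpha> g v) \<le> vertex_dist X u v"
proof -
  have adj: "(\<alpha> g a, \<alpha> g b) \<in> arcs_ends X" if "(a, b) \<in> arcs_ends X" for a b
  proof -
    from that obtain e where e: "e \<in> arcs X" "a = tail X e" "b = head X e"
      by (auto simp: arcs_ends_def arc_to_ends_def)
    then have "(tail X (\<beta> g e), head X (\<beta> g e)) \<in> arcs_ends X"
      using arc_closed assms(1) by (blast intro: in_arcs_imp_in_arcs_ends)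
    then show ?thesis using e assms(1) by (simp add: tail_act head_act)
  qed
  have "(\<alpha> g u, \<alpha> g w) \<in> arcs_ends X ^^ n" if "(u, w) \<in> arcs_ends X ^^ n" for w n
    using that by (induction n arbitrary: w) (auto intro: adj)
  then show ?thesis using assms relpow_vertex_dist by (intro vertex_dist_le) auto
qed

lemma vertex_dist_act [simp]:
  assumes "g \<in> carrier G" "u \<in> verts X" "v \<in> verts X"
  shows "vertex_dist X (\<alpha> g u) (\<alpha> g v) = vertex_dist X u v"
proof (rule antisym[OF vertex_dist_act_le[OF assms]])
  have "vertex_dist X (\<alpha> (inv g) (\<alpha> g u)) (\<alpha> (inv g) (\<alpha> g v)) \<le> vertex_dist X (\<alpha> g u) (\<alpha> g v)"
    using assms by (intro vertex_dist_act_le) auto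
  then show "vertex_dist X u v \<le> vertex_dist X (\<alpha> g u) (\<alpha> g v)"
    using assms by (simp flip: vert_mult)
qed

abbreviation action where "action \<equiv> realization_action X \<iota> \<alpha> \<beta>"

lemma action_Inl [simp]: "v \<in> verts X \<Longrightarrow> action g (Inl v) = Inl (\<alpha> g v)"
  by (simp add: realization_action_def)

lemma action_closed:
  assumes "g \<in> carrier G" "z \<in> realization X \<iota>"
  shows "action g z \<in> realization X \<iota>"
  using assms(2)
proof (cases rule: realization_cases)
  case (inner e t)
  then have "action g z = Inr {(\<beta> g e, t), (\<iota> (\<beta> g e), 1 - t)}"
    using assms by (simp add: realization_action_def rev_act)
  then show ?thesis using inner arc_closed[OF assms(1), of e] unfolding realization_def by blast
qed (use assms in simp)

text \<open>One vertex works for all \<open>g\<close>: \<open>z\<close> itself or the tail of its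
  edge, since the action carries an edge along with its tail and parameter.\<close>

lemma action_near_vertex:
  assumes "z \<in> realization X \<iota>"
  obtains v where "v \<in> verts X"
    "\<And>g. g \<in> carrier G \<Longrightarrow> graph_dist X \<iota> (action g z) (Inl (\<alpha> g v)) \<le> 1"
  using assms
proof (cases rule: realization_cases)
  case (vertex v)
  then show ?thesis using that[of v] vertex_dist_zero[of v v] by simp
next
  case (inner e t)
  have "graph_dist X \<iota> (action g z) (Inl (\<alpha> g (tail X e))) \<le> 1" if g: "g \<in> carrier G" for g
  proof -
    have "action g z = Inr {(\<beta> g e, t), (\<iota> (\<beta> g e), 1 - t)}"
      using inner g assms by (simp add: realization_action_def rev_act)
    then have "(\<alpha> g (tail X e), t) \<in> endpoints X (action g z)"
      using inner g by (simp add: tail_act)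
    then have "t + real (vertex_dist X (\<alpha> g (tail X e)) (\<alpha> g (tail X e))) + 0
        \<in> lengths (action g z) (Inl (\<alpha> g (tail X e)))"
      unfolding lengths_def by fastforce
    then have "graph_dist X \<iota> (action g z) (Inl (\<alpha> g (tail X e))) \<le>
        t + real (vertex_dist X (\<alpha> g (tail X e)) (\<alpha> g (tail X e))) + 0"
      using g inner action_closed[OF g assms] by (intro graph_dist_le) auto
    moreover have "vertex_dist X (\<alpha> g (tail X e)) (\<alpha> g (tail X e)) = 0"
      using g inner vertex_dist_zero[of "\<alpha> g (tail X e)" "\<alpha> g (tail X e)"] by simp
    ultimately show ?thesis using inner by simp
  qed
  then show ?thesis using inner that[of "tail X e"] by simp
qed

text \<open>The additive constant is independent of the group elements. Hence every notion stated
  for some base point of the realization can be tested on vertex distances at any vertex.\<close>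

lemma orbit_dist_comparison:
  assumes z: "z \<in> realization X \<iota>" and v: "v \<in> verts X"
  obtains K :: nat where "\<And>g h. g \<in> carrier G \<Longrightarrow> h \<in> carrier G \<Longrightarrow>
    \<bar>graph_dist X \<iota> (action g z) (action h z) - real (vertex_dist X (\<alpha> g v) (\<alpha> h v))\<bar> \<le> real K"
proof -
  interpret Metric_space "realization X \<iota>" "graph_dist X \<iota>" by (rule Metric_space_realization)
  obtain u where u: "u \<in> verts X"
    "\<And>g. g \<in> carrier G \<Longrightarrow> graph_dist X \<iota> (action g z) (Inl (\<alpha> g u)) \<le> 1"
    using action_near_vertex[OF z] by blast
  have near: "graph_dist X \<iota> (action g z) (Inl (\<alpha> g v)) \<le> 1 + vertex_dist X u v"
    if g: "g \<in> carrier G" for g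
  proof -
    have "graph_dist X \<iota> (action g z) (Inl (\<alpha> g v)) \<le>
        graph_dist X \<iota> (action g z) (Inl (\<alpha> g u)) + graph_dist X \<iota> (Inl (\<alpha> g u)) (Inl (\<alpha> g v))"
      by (rule triangle) (use g u v z action_closed in auto)
    then show ?thesis using u(1) u(2)[OF g] g v by simp
  qed
  show ?thesis
  proof (rule that[of "2 * (1 + vertex_dist X u v)"])
    fix g h assume g: "g \<in> carrier G" and h: "h \<in> carrier G"
    have M: "action g z \<in> realization X \<iota>" "action h z \<in> realization X \<iota>"
      "Inl (\<alpha> g v) \<in> realization X \<iota>" "Inl (\<alpha> h v) \<in> realization X \<iota>"
      using g h z v action_closed by auto
    have "graph_dist X \<iota> (Inl (\<alpha> g v)) (Inl (\<alpha> h v)) = vertex_dist X (\<alpha> g v) (\<alpha> h v)"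
      using g h v by (intro graph_dist_Inl) auto
    then show "\<bar>graph_dist X \<iota> (action g z) (action h z) - real (vertex_dist X (\<alpha> g v) (\<alpha> h v))\<bar>
        \<le> real (2 * (1 + vertex_dist X u v))"
      using near[OF g] near[OF h] triangle[OF M(1,3,2)] triangle[OF M(3,4,2)]
        triangle[OF M(3,1,4)] triangle[OF M(1,2,4)] commute[of "action g z" "Inl (\<alpha> g v)"]
        commute[of "action h z" "Inl (\<alpha> h v)"] by simp
  qed
qed

lemma vertex_dist_int_pow:
  assumes "g \<in> carrier G" "v \<in> verts X"
  shows "vertex_dist X (\<alpha> (g [^] (m::int)) v) (\<alpha> (g [^] (n::int)) v) =
    vertex_dist X v (\<alpha> (g [^] nat \<bar>m - n\<bar>) v)"
proof -
  have *: "vertex_dist X (\<alpha> (g [^] m) v) (\<alpha> (g [^] n) v) = vertex_dist X v (\<alpha> (g [^] nat (n - m)) v)"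
    if "m \<le> n" for m n :: int
  proof -
    have "g [^] n = g [^] (m + int (nat (n - m)))" using that by simp
    also have "\<dots> = g [^] m \<otimes> g [^] nat (n - m)"
      using assms(1) by (simp only: int_pow_mult int_pow_int)
    finally have "g [^] n = g [^] m \<otimes> g [^] nat (n - m)" .
    then show ?thesis using assms by (simp add: vert_mult)
  qed
  show ?thesis
  proof (cases "m \<le> n")
    case False
    then have "vertex_dist X (\<alpha> (g [^] m) v) (\<alpha> (g [^] n) v) = vertex_dist X (\<alpha> (g [^] n) v) (\<alpha> (g [^] m) v)"
      using assms by (intro vertex_dist_sym) auto
    then show ?thesis using False *[of n m] by simp
  qed (simp add: *)
qed

lemma vertex_dist_pow_le:
  assumes "g \<in> carrier G" "v \<in> verts X"
  shows "vertex_dist X v (\<alpha> (g [^] (n::nat)) v) \<le> n * vertex_dist X v (\<alpha> g v)"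
proof (induction n)
  case (Suc n)
  have "vertex_dist X v (\<alpha> (g [^] Suc n) v) \<le>
      vertex_dist X v (\<alpha> (g [^] n) v) + vertex_dist X (\<alpha> (g [^] n) v) (\<alpha> (g [^] Suc n) v)"
    using assms by (intro vertex_dist_triangle) auto
  also have "vertex_dist X (\<alpha> (g [^] n) v) (\<alpha> (g [^] Suc n) v) = vertex_dist X v (\<alpha> g v)"
    using assms by (simp add: vert_mult)
  finally show ?case using Suc by simp
qed (use assms in \<open>simp add: vertex_dist_zero\<close>)

lemma acts_elliptically_iff:
  assumes g: "g \<in> carrier G" and v: "v \<in> verts X"
  shows "acts_elliptically G (realization X \<iota>) (graph_dist X \<iota>) action g \<longleftrightarrow>
    (\<exists>B. \<forall>n::nat. vertex_dist X v (\<alpha> (g [^] n) v) \<le> B)" (is "?L \<longleftrightarrow> ?R")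
proof
  interpret Metric_space "realization X \<iota>" "graph_dist X \<iota>" by (rule Metric_space_realization)
  {
    assume ?L
    then obtain z where z: "z \<in> realization X \<iota>"
      and bdd: "mbounded (range (\<lambda>n::int. action (g [^] n) z))"
      unfolding acts_elliptically_def by blast
    define orbit where "orbit = range (\<lambda>n::int. action (g [^] n) z)"
    obtain B where "\<forall>p\<in>orbit. \<forall>q\<in>orbit. graph_dist X \<iota> p q \<le> B"
      using bdd unfolding mbounded_alt orbit_def[symmetric] by blast
    then have B: "graph_dist X \<iota> (action (g [^] m) z) (action (g [^] n) z) \<le> B" for m n :: int
      unfolding orbit_def by blast
    obtain K where K: "\<And>g h. g \<in> carrier G \<Longrightarrow> h \<in> carrier G \<Longrightarrow>
        \<bar>graph_dist X \<iota> (action g z) (action h z) - vertex_dist X (\<alpha> g v) (\<alpha> h v)\<bar> \<le> real K"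
      using orbit_dist_comparison[OF z v] by blast
    have "vertex_dist X v (\<alpha> (g [^] n) v) \<le> nat \<lceil>B\<rceil> + K" for n :: nat
    proof -
      have "graph_dist X \<iota> (action \<one> z) (action (g [^] n) z) \<le> B"
        using B[of 0 "int n"] by (simp add: int_pow_int)
      then have "real (vertex_dist X v (\<alpha> (g [^] n) v)) \<le> B + K"
        using K[of "\<one>" "g [^] n"] g v by simp
      then show ?thesis by linarith
    qed
    then show ?R by blast
  next
    assume ?R
    then obtain B where B: "\<And>n::nat. vertex_dist X v (\<alpha> (g [^] n) v) \<le> B" by blast
    have "graph_dist X \<iota> (action (g [^] m) (Inl v)) (action (g [^] n) (Inl v)) \<le> B" for m n :: int
      using B[of "nat \<bar>m - n\<bar>"] g v by (simp add: vertex_dist_int_pow)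
    moreover have "range (\<lambda>n::int. action (g [^] n) (Inl v)) \<subseteq> realization X \<iota>"
      using g v by auto
    ultimately have "mbounded (range (\<lambda>n::int. action (g [^] n) (Inl v)))"
      unfolding mbounded_alt by blast
    then show ?L using v unfolding acts_elliptically_def by (intro bexI[of _ "Inl v"]) auto
  }
qed

text \<open>Subadditivity bounds the displacement of powers linearly from above for any
  \<open>g\<close>, and differences of integers reduce to natural exponents; a linear lower bound is
  all that remains.\<close>

lemma acts_loxodromically_iff:
  assumes g: "g \<in> carrier G" and v: "v \<in> verts X"
  shows "acts_loxodromically G (realization X \<iota>) (graph_dist X \<iota>) action g \<longleftrightarrow>
    (\<exists>c>0. \<exists>C. \<forall>n::nat. c * real n - C \<le> vertex_dist X v (\<alpha> (g [^] n) v))" (is "?L \<longleftrightarrow> ?R")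
proof
  assume ?L
  then obtain z where z: "z \<in> realization X \<iota>" and qi: "qi_embedding UNIV
      (\<lambda>m n::int. real_of_int \<bar>m - n\<bar>) (realization X \<iota>) (graph_dist X \<iota>) (\<lambda>n. action (g [^] n) z)"
    unfolding acts_loxodromically_def by blast
  obtain L C where L: "L \<ge> 1" and C: "\<And>m n::int. real_of_int \<bar>m - n\<bar> / L - C \<le>
      graph_dist X \<iota> (action (g [^] m) z) (action (g [^] n) z)"
    using qi unfolding qi_embedding_def by blast
  obtain K where K: "\<And>g h. g \<in> carrier G \<Longrightarrow> h \<in> carrier G \<Longrightarrow>
      \<bar>graph_dist X \<iota> (action g z) (action h z) - vertex_dist X (\<alpha> g v) (\<alpha> h v)\<bar> \<le> real K"
    using orbit_dist_comparison[OF z v] by blast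
  have "(1 / L) * real n - (C + K) \<le> vertex_dist X v (\<alpha> (g [^] n) v)" for n :: nat
  proof -
    have "real n / L - C \<le> graph_dist X \<iota> (action \<one> z) (action (g [^] n) z)"
      using C[of 0 "int n"] by (simp add: int_pow_int)
    then show ?thesis using K[of "\<one>" "g [^] n"] g v by simp
  qed
  then show ?R using L by (intro exI[of _ "1 / L"]) auto
next
  assume ?R
  then obtain c C where c: "c > 0" and C: "\<And>n::nat. c * real n - C \<le> vertex_dist X v (\<alpha> (g [^] n) v)"
    by blast
  \<comment> \<open>\<open>1 / c\<close> serves the lower estimate, the displacement of
    \<open>v\<close> by \<open>g\<close> the upper one.\<close>
  define L where "L = max 1 (max (1 / c) (vertex_dist X v (\<alpha> g v)))"
  have L: "L \<ge> 1" "1 / c \<le> L" "vertex_dist X v (\<alpha> g v) \<le> L" by (auto simp: L_def)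
  have "1 / L \<le> c" using L c by (simp add: field_simps)
  have low: "real_of_int \<bar>m - n\<bar> / L - \<bar>C\<bar> \<le>
      graph_dist X \<iota> (action (g [^] m) (Inl v)) (action (g [^] n) (Inl v))" for m n :: int
  proof -
    have "real_of_int \<bar>m - n\<bar> / L \<le> c * real_of_int \<bar>m - n\<bar>"
      using mult_right_mono[OF \<open>1 / L \<le> c\<close>, of "real_of_int \<bar>m - n\<bar>"] by simp
    then show ?thesis using C[of "nat \<bar>m - n\<bar>"] g v by (simp add: vertex_dist_int_pow)
  qed
  have up: "graph_dist X \<iota> (action (g [^] m) (Inl v)) (action (g [^] n) (Inl v)) \<le>
      L * real_of_int \<bar>m - n\<bar> + \<bar>C\<bar>" for m n :: int
  proof -
    have "real (vertex_dist X v (\<alpha> (g [^] nat \<bar>m - n\<bar>) v)) \<le> real (nat \<bar>m - n\<bar> * vertex_dist X v (\<alpha> g v))"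
      using vertex_dist_pow_le[OF g v] of_nat_le_iff by blast
    also have "\<dots> \<le> L * real_of_int \<bar>m - n\<bar>"
      using mult_right_mono[OF L(3), of "real_of_int \<bar>m - n\<bar>"] by (simp add: mult.commute)
    finally show ?thesis using g v by (simp add: vertex_dist_int_pow)
  qed
  show ?L
    unfolding acts_loxodromically_def qi_embedding_def
    using v g L(1) low up by (intro bexI[of _ "Inl v"] conjI exI[of _ L] exI[of _ "\<bar>C\<bar>"]) auto
qed

end

lemma relpow_mono_set:
  fixes r s :: "('a \<times> 'a) set"
  shows "r \<subseteq> s \<Longrightarrow> r ^^ n \<subseteq> s ^^ n"
  by (induction n) (simp_all add: relcomp_mono)

section \<open>Words over a finite generating set\<close>

context group begin

lemma foldr_mult_closed: "set ws \<subseteq> carrier G \<Longrightarrow> foldr (\<otimes>) ws \<one> \<in> carrier G"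
  by (induction ws) auto

lemma foldr_mult_append:
  "set ws \<subseteq> carrier G \<Longrightarrow> set ws' \<subseteq> carrier G \<Longrightarrow>
   foldr (\<otimes>) (ws @ ws') \<one> = foldr (\<otimes>) ws \<one> \<otimes> foldr (\<otimes>) ws' \<one>"
  by (induction ws) (auto simp: foldr_mult_closed m_assoc)

lemma generate_imp_word:
  assumes "S \<subseteq> carrier G" "h \<in> generate G S"
  shows "\<exists>ws. set ws \<subseteq> S \<union> (\<lambda>s. inv s) ` S \<and> foldr (\<otimes>) ws \<one> = h"
  using assms(2)
proof induction
  case one
  show ?case by (intro exI[of _ "[]"]) simp
next
  case (incl h)
  then show ?case using assms(1) by (intro exI[of _ "[h]"]) auto
next
  case (inv h)
  then show ?case using assms(1) by (intro exI[of _ "[inv h]"]) auto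
next
  case (eng h1 h2)
  then obtain ws1 ws2 where ws: "set ws1 \<subseteq> S \<union> (\<lambda>s. inv s) ` S" "foldr (\<otimes>) ws1 \<one> = h1"
    "set ws2 \<subseteq> S \<union> (\<lambda>s. inv s) ` S" "foldr (\<otimes>) ws2 \<one> = h2" by blast
  moreover have "S \<union> (\<lambda>s. inv s) ` S \<subseteq> carrier G" using assms(1) by auto
  ultimately have "foldr (\<otimes>) (ws1 @ ws2) \<one> = h1 \<otimes> h2"
    using foldr_mult_append[of ws1 ws2] by (metis order_trans)
  then show ?case using ws by (intro exI[of _ "ws1 @ ws2"]) auto
qed

lemma word_length_attained:
  assumes "S \<subseteq> carrier G" "h \<in> generate G S"
  obtains ws where "length ws = word_length G S h" "set ws \<subseteq> S \<union> (\<lambda>s. inv s) ` S"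
    "foldr (\<otimes>) ws \<one> = h"
proof -
  have "\<exists>n ws. length ws = n \<and> set ws \<subseteq> S \<union> (\<lambda>s. inv s) ` S \<and> foldr (\<otimes>) ws \<one> = h"
    using generate_imp_word[OF assms] by blast
  then have "\<exists>ws. length ws = word_length G S h \<and> set ws \<subseteq> S \<union> (\<lambda>s. inv s) ` S \<and> foldr (\<otimes>) ws \<one> = h"
    unfolding word_length_def by (rule LeastI_ex)
  then show ?thesis using that by blast
qed

lemma finite_word_ball:
  assumes "finite S" "S \<subseteq> carrier G"
  shows "finite {h \<in> generate G S. word_length G S h \<le> n}"
proof -
  define L where "L = {ws. set ws \<subseteq> S \<union> (\<lambda>s. inv s) ` S \<and> length ws \<le> n}"
  have "finite L" unfolding L_def using assms(1) by (intro finite_lists_length_le) auto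
  moreover have "{h \<in> generate G S. word_length G S h \<le> n} \<subseteq> (\<lambda>ws. foldr (\<otimes>) ws \<one>) ` L"
  proof
    fix h assume h: "h \<in> {h \<in> generate G S. word_length G S h \<le> n}"
    then obtain ws where "length ws = word_length G S h" "set ws \<subseteq> S \<union> (\<lambda>s. inv s) ` S"
      "foldr (\<otimes>) ws \<one> = h" using word_length_attained[OF assms(2)] by blast
    then show "h \<in> (\<lambda>ws. foldr (\<otimes>) ws \<one>) ` L" using h unfolding L_def by auto
  qed
  ultimately show ?thesis by (rule finite_surj)
qed

end

section \<open>Types of elements via powers, and the A/QI hypotheses at a vertex\<close>

context graph_automorphisms begin

text \<open>Dividing the exponent by \<open>m\<close> leaves finitely many remainders, whose
  displacements are bounded together by the sum over \<open>r < m\<close>.\<close>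

lemma acts_elliptically_if_power_bounded:
  assumes g: "g \<in> carrier G" and v: "v \<in> verts X" and m: "0 < (m::nat)"
    and B: "\<And>q::nat. vertex_dist X v (\<alpha> ((g [^] m) [^] q) v) \<le> B"
  shows "acts_elliptically G (realization X \<iota>) (graph_dist X \<iota>) action g"
proof -
  have "vertex_dist X v (\<alpha> (g [^] n) v) \<le> B + (\<Sum>r<m. vertex_dist X v (\<alpha> (g [^] r) v))" for n :: nat
  proof -
    have "g [^] n = g [^] (m * (n div m) + n mod m)" by simp
    also have "\<dots> = (g [^] m) [^] (n div m) \<otimes> g [^] (n mod m)"
      using g by (simp only: nat_pow_mult[symmetric] nat_pow_pow)
    finally have "\<alpha> (g [^] n) v = \<alpha> ((g [^] m) [^] (n div m)) (\<alpha> (g [^] (n mod m)) v)"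
      using g v by (simp add: vert_mult)
    moreover have "vertex_dist X v (\<alpha> ((g [^] m) [^] (n div m)) (\<alpha> (g [^] (n mod m)) v)) \<le>
        vertex_dist X v (\<alpha> ((g [^] m) [^] (n div m)) v) +
        vertex_dist X (\<alpha> ((g [^] m) [^] (n div m)) v) (\<alpha> ((g [^] m) [^] (n div m)) (\<alpha> (g [^] (n mod m)) v))"
      using g v by (intro vertex_dist_triangle) auto
    moreover have "vertex_dist X v (\<alpha> (g [^] (n mod m)) v) \<le> (\<Sum>r<m. vertex_dist X v (\<alpha> (g [^] r) v))"
      using m by (intro member_le_sum) auto
    ultimately show ?thesis using B[of "n div m"] g v by simp
  qed
  then show ?thesis using acts_elliptically_iff[OF g v] by blast
qed

lemma acts_loxodromically_if_power_grows:
  assumes g: "g \<in> carrier G" and v: "v \<in> verts X" and l: "0 < (l::nat)"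
    and grow: "\<And>n::nat. n \<le> vertex_dist X v (\<alpha> ((g [^] l) [^] n) v)"
  shows "acts_loxodromically G (realization X \<iota>) (graph_dist X \<iota>) action g"
proof -
  define M where "M = (\<Sum>r<l. vertex_dist X v (\<alpha> (g [^] r) v))"
  have "1 / real l * real n - real (1 + M) \<le> vertex_dist X v (\<alpha> (g [^] n) v)" for n :: nat
  proof -
    define f where "f = (g [^] l) [^] (n div l)"
    define r where "r = g [^] (n mod l)"
    have fr: "f \<in> carrier G" "r \<in> carrier G" using g by (simp_all add: f_def r_def)
    have "g [^] n = g [^] (l * (n div l) + n mod l)" by simp
    also have "\<dots> = f \<otimes> r"
      using g unfolding f_def r_def by (simp only: nat_pow_mult[symmetric] nat_pow_pow)
    finally have "\<alpha> (g [^] n) v = \<alpha> f (\<alpha> r v)" using fr v by (simp add: vert_mult)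
    moreover have "vertex_dist X v (\<alpha> f v) \<le>
        vertex_dist X v (\<alpha> f (\<alpha> r v)) + vertex_dist X (\<alpha> f (\<alpha> r v)) (\<alpha> f v)"
      using fr v by (intro vertex_dist_triangle) auto
    moreover have "vertex_dist X (\<alpha> f (\<alpha> r v)) (\<alpha> f v) = vertex_dist X v (\<alpha> r v)"
      using fr v vertex_dist_sym[of v "\<alpha> r v"] by simp
    moreover have "vertex_dist X v (\<alpha> r v) \<le> M"
      unfolding M_def r_def using l by (intro member_le_sum) auto
    ultimately have "n div l \<le> vertex_dist X v (\<alpha> (g [^] n) v) + M"
      using grow[of "n div l"] unfolding f_def by simp
    moreover have "real n / real l \<le> real (n div l) + 1"
      by (metis add.commute floor_divide_of_nat_eq less_le linorder_not_le not_less of_int_of_nat_eq real_of_int_floor_add_one_gt)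
    ultimately show ?thesis by simp
  qed
  then show ?thesis using l unfolding acts_loxodromically_iff[OF g v]
    by (intro exI[of _ "1 / real l"] conjI exI[of _ "real (1 + M)"] allI) auto
qed

lemma hyperbolic_vertices_if_gromov_hyperbolic:
  assumes "gromov_hyperbolic (realization X \<iota>) (graph_dist X \<iota>)"
  obtains \<delta> where "hyperbolic_vertices (verts X) (vertex_dist X) \<delta>"
proof -
  obtain \<delta> where \<delta>: "\<And>x y z w. x \<in> realization X \<iota> \<Longrightarrow> y \<in> realization X \<iota> \<Longrightarrow> z \<in> realization X \<iota> \<Longrightarrow>
      w \<in> realization X \<iota> \<Longrightarrow> graph_dist X \<iota> x y + graph_dist X \<iota> z w \<le>
      max (graph_dist X \<iota> x z + graph_dist X \<iota> y w) (graph_dist X \<iota> x w + graph_dist X \<iota> y z) + 2 * \<delta>"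
    using assms unfolding gromov_hyperbolic_def by blast
  \<comment> \<open>The error in the definition is \<open>2 * \<delta>\<close>; rounding it up makes
    the inequality one of natural numbers.\<close>
  have "hyperbolic_vertices (verts X) (vertex_dist X) (nat \<lceil>2 * \<delta>\<rceil>)"
  proof
    fix x y z w assume V: "x \<in> verts X" "y \<in> verts X" "z \<in> verts X" "w \<in> verts X"
    have "real (vertex_dist X x y + vertex_dist X z w) \<le>
        real (max (vertex_dist X x z + vertex_dist X y w) (vertex_dist X x w + vertex_dist X y z)) + 2 * \<delta>"
      using \<delta>[of "Inl x" "Inl y" "Inl z" "Inl w"] V by (simp add: of_nat_max)
    then show "vertex_dist X x y + vertex_dist X z w \<le>
        max (vertex_dist X x z + vertex_dist X y w) (vertex_dist X x w + vertex_dist X y z) + nat \<lceil>2 * \<delta>\<rceil>"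
      by linarith
  qed (rule vertex_dist_zero vertex_dist_sym vertex_dist_triangle vertex_dist_interval; assumption)+
  then show ?thesis by (rule that)
qed

lemma isometric_vertex_action:
  assumes "hyperbolic_vertices (verts X) (vertex_dist X) \<delta>"
  shows "isometric_vertex_action (verts X) (vertex_dist X) \<delta> G \<alpha>"
  by (intro isometric_vertex_action.intro assms is_group isometric_vertex_action_axioms.intro)
    (simp_all add: vert_mult)

text \<open>If \<open>g^l\<close> drifted at \<open>p\<close>,
  \<open>drift_imp_linear_growth\<close> would make its orbit, hence that of \<open>g\<close>, grow
  linearly. Exponent \<open>0\<close> cannot drift; it is excluded because passing from
  \<open>g^l\<close> to \<open>g\<close> divides the slope by \<open>l\<close>.\<close>

lemma no_drift_if_not_loxodromic:
  assumes "hyperbolic_vertices (verts X) (vertex_dist X) \<delta>"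
    and g: "g \<in> carrier G"
    and nonlox: "\<not> acts_loxodromically G (realization X \<iota>) (graph_dist X \<iota>) action g"
    and p: "p \<in> verts X"
  shows "vertex_dist X p (\<alpha> (g [^] (l::nat)) (\<alpha> (g [^] l) p)) \<le> vertex_dist X p (\<alpha> (g [^] l) p) + \<delta>"
proof (rule ccontr)
  interpret hyperbolic_vertices "verts X" "vertex_dist X" \<delta> by fact
  assume drift: "\<not> ?thesis"
  define f where "f = g [^] l"
  have f: "f \<in> carrier G" using g by (simp add: f_def)
  have "0 < l"
  proof (rule ccontr)
    assume "\<not> 0 < l"
    then show False using drift p by (simp add: vertex_dist_zero)
  qed
  have "n \<le> vertex_dist X p (\<alpha> (f [^] n) p)" for n :: nat
  proof (rule drift_imp_linear_growth[where z = "\<lambda>n::nat. \<alpha> (f [^] n) p"])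
    show "vertex_dist X (\<alpha> (f [^] m) p) (\<alpha> (f [^] (m + n)) p) = vertex_dist X p (\<alpha> (f [^] n) p)" for m n :: nat
      using f p by (simp add: vert_mult flip: nat_pow_mult)
    have "f [^] (2::nat) = f \<otimes> f" using f by (simp add: numeral_2_eq_2)
    then show "vertex_dist X p (\<alpha> (f [^] (1::nat)) p) + \<delta> < vertex_dist X p (\<alpha> (f [^] (2::nat)) p)"
      using drift f p by (simp add: vert_mult f_def[symmetric])
  qed (use f p in simp)
  then have "acts_loxodromically G (realization X \<iota>) (graph_dist X \<iota>) action g"
    using acts_loxodromically_if_power_grows[OF g p \<open>0 < l\<close>] unfolding f_def by blast
  then show False using nonlox by contradiction
qed

text \<open>Each hypothesis has its own base point in the realization;
  \<open>orbit_dist_comparison\<close> moves it to \<open>x\<close> at the cost of an additive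
  \<open>K\<close>, absorbed into \<open>B\<close> and into the acylindricity constants.\<close>

lemma coned_action_if_AQI:
  assumes AQI: "AQI_triple G (realization X \<iota>) (graph_dist X \<iota>) action H"
    and hyp: "hyperbolic_vertices (verts X) (vertex_dist X) \<delta>" and x: "x \<in> verts X"
  obtains \<mu> A B where "coned_action (verts X) (vertex_dist X) \<delta> G \<alpha> H x \<mu> A B"
proof -
  have H: "subgroup H G" and iso: "isometric_action G (realization X \<iota>) (graph_dist X \<iota>) action"
    using AQI by (auto simp: AQI_triple_def)
  have HG: "H \<subseteq> carrier G" using H by (rule subgroup.subset)
  have one_H: "\<one> \<in> H" using H by (rule subgroup.one_closed)
  obtain S z where S: "finite S" "S \<subseteq> H" "generate G S = H" and z: "z \<in> realization X \<iota>" and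
    "qi_embedding H (word_dist G S) (realization X \<iota>) (graph_dist X \<iota>) (\<lambda>h. action h z)"
    using AQI unfolding AQI_triple_def qi_embedded_by_action_def finite_generating_set_def by blast
  then obtain L C where L: "L \<ge> 1" and C: "C \<ge> 0" and qi: "\<And>a b. a \<in> H \<Longrightarrow> b \<in> H \<Longrightarrow>
      word_dist G S a b / L - C \<le> graph_dist X \<iota> (action a z) (action b z)"
    unfolding qi_embedding_def by blast
  have SG: "S \<subseteq> carrier G" using S HG by blast
  obtain K where K: "\<And>g h. g \<in> carrier G \<Longrightarrow> h \<in> carrier G \<Longrightarrow>
      \<bar>graph_dist X \<iota> (action g z) (action h z) - vertex_dist X (\<alpha> g x) (\<alpha> h x)\<bar> \<le> real K"
    using orbit_dist_comparison[OF z x] by blast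
  define A where "A = nat \<lceil>L\<rceil>"
  define B where "B = nat \<lceil>L * (K + C)\<rceil>"
  have wl: "word_length G S (inv a \<otimes> b) \<le> A * vertex_dist X (\<alpha> a x) (\<alpha> b x) + B"
    if ab: "a \<in> H" "b \<in> H" for a b
  proof -
    have "word_dist G S a b / L \<le> real (vertex_dist X (\<alpha> a x) (\<alpha> b x)) + (K + C)"
      using qi[OF ab] K[of a b] ab HG by fastforce
    then have "word_dist G S a b \<le> L * real (vertex_dist X (\<alpha> a x) (\<alpha> b x)) + L * (K + C)"
      using L by (simp add: divide_le_eq algebra_simps)
    also have "\<dots> \<le> real A * real (vertex_dist X (\<alpha> a x) (\<alpha> b x)) + real B"
      unfolding A_def B_def using L by (intro add_mono mult_right_mono) linarith+
    finally have "real (word_length G S (inv a \<otimes> b)) \<le> real (A * vertex_dist X (\<alpha> a x) (\<alpha> b x) + B)"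
      by (simp add: word_dist_def)
    then show ?thesis by (simp only: of_nat_le_iff)
  qed
  define SS where "SS = S \<union> (\<lambda>s. inv s) ` S"
  have SS: "finite SS" "SS \<subseteq> H" "SS \<subseteq> carrier G"
    using S SG H by (auto simp: SS_def subgroup.m_inv_closed)
  define \<mu> where "\<mu> = (\<Sum>s\<in>SS. vertex_dist X x (\<alpha> s x))"
  have "coned_action (verts X) (vertex_dist X) \<delta> G \<alpha> H x \<mu> A B"
  proof (intro coned_action.intro isometric_vertex_action hyp coned_action_axioms.intro H x)
    fix \<rho>
    have "{h \<in> H. vertex_dist X x (\<alpha> h x) \<le> \<rho>} \<subseteq> {h \<in> generate G S. word_length G S h \<le> A * \<rho> + B}"
    proof safe
      fix h assume h: "h \<in> H" "vertex_dist X x (\<alpha> h x) \<le> \<rho>"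
      then show "h \<in> generate G S" using S by simp
      have "word_length G S h \<le> A * vertex_dist X x (\<alpha> h x) + B"
        using wl[OF one_H h(1)] h HG x by (simp add: subsetD)
      also have "\<dots> \<le> A * \<rho> + B" using h(2) by simp
      finally show "word_length G S h \<le> A * \<rho> + B" .
    qed
    then show "finite {h \<in> H. vertex_dist X x (\<alpha> h x) \<le> \<rho>}"
      using finite_word_ball[OF S(1) SG] finite_subset by blast
  next
    fix h h' assume h: "h \<in> H" "h' \<in> H"
    then have hG: "h \<in> carrier G" "h' \<in> carrier G" using HG by auto
    have "inv h \<otimes> h' \<in> generate G S"
      using h H S(3) by (simp add: subgroup.m_closed subgroup.m_inv_closed)
    then obtain ws where ws: "length ws = word_length G S (inv h \<otimes> h')" "set ws \<subseteq> SS"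
      "foldr (\<otimes>) ws \<one> = inv h \<otimes> h'"
      using word_length_attained[OF SG] unfolding SS_def by blast
    \<comment> \<open>Prefixes of a shortest word for \<open>inv h \<otimes> h'\<close>, translated
      by \<open>h\<close>; appending a letter moves the orbit point by at most \<mu>.\<close>
    define w where "w i = h \<otimes> foldr (\<otimes>) (take i ws) \<one>" for i
    have wH: "w i \<in> H" for i
    proof -
      have "foldr (\<otimes>) us \<one> \<in> H" if "set us \<subseteq> H" for us
        using that by (induction us) (auto simp: one_H intro: subgroup.m_closed[OF H])
      moreover have "set (take i ws) \<subseteq> H" using ws(2) SS set_take_subset by fast
      ultimately show ?thesis unfolding w_def using h H by (intro subgroup.m_closed) auto
    qed
    have "vertex_dist X (\<alpha> (w i) x) (\<alpha> (w (Suc i)) x) \<le> \<mu>" if i: "i < length ws" for i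
    proof -
      have s: "ws ! i \<in> SS" using ws i by auto
      have t: "set (take i ws) \<subseteq> carrier G" using ws(2) SS(3) set_take_subset by fast
      have "w (Suc i) = w i \<otimes> ws ! i"
        using s SS(3) t i hG foldr_mult_append[of "take i ws" "[ws ! i]"] unfolding w_def
        by (auto simp: take_Suc_conv_app_nth m_assoc foldr_mult_closed)
      then have "vertex_dist X (\<alpha> (w i) x) (\<alpha> (w (Suc i)) x) = vertex_dist X x (\<alpha> (ws ! i) x)"
        using wH[of i] HG SS(3) s x by (auto simp: vert_mult subset_iff)
      also have "\<dots> \<le> \<mu>" unfolding \<mu>_def using s SS(1) by (intro member_le_sum) auto
      finally show ?thesis .
    qed
    moreover have "w 0 = h" "w (length ws) = h'"
      using hG ws by (auto simp: w_def simp flip: m_assoc)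
    moreover have "length ws \<le> A * vertex_dist X (\<alpha> h x) (\<alpha> h' x) + B" using wl[OF h] ws by simp
    ultimately show "\<exists>w n. (\<forall>i\<le>n. w i \<in> H) \<and> w 0 = h \<and> w n = h' \<and>
        (\<forall>i<n. vertex_dist X (\<alpha> (w i) x) (\<alpha> (w (Suc i)) x) \<le> \<mu>) \<and>
        n \<le> A * vertex_dist X (\<alpha> h x) (\<alpha> h' x) + B"
      using wH by (intro exI[of _ w] exI[of _ "length ws"]) auto
  next
    fix \<epsilon> :: nat
    obtain z where z: "z \<in> realization X \<iota>" and
      acyl: "acylindrical_along G (graph_dist X \<iota>) action ((\<lambda>h. action h z) ` H)"
      using AQI unfolding AQI_triple_def acylindrical_along_subgroup_def by blast
    obtain K where K: "\<And>g h. g \<in> carrier G \<Longrightarrow> h \<in> carrier G \<Longrightarrow>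
        \<bar>graph_dist X \<iota> (action g z) (action h z) - vertex_dist X (\<alpha> g x) (\<alpha> h x)\<bar> \<le> real K"
      using orbit_dist_comparison[OF z x] by blast
    \<comment> \<open>Tolerance \<epsilon> at \<open>x\<close> becomes \<open>\<epsilon> + K\<close>
      at \<open>z\<close>; the distance threshold below is raised by \<open>K\<close>
      likewise.\<close>
    obtain R where R: "\<And>p q. p \<in> (\<lambda>h. action h z) ` H \<Longrightarrow> q \<in> (\<lambda>h. action h z) ` H \<Longrightarrow>
        R \<le> graph_dist X \<iota> p q \<Longrightarrow> finite {g \<in> carrier G.
          graph_dist X \<iota> (action g p) p \<le> real (\<epsilon> + K) \<and> graph_dist X \<iota> (action g q) q \<le> real (\<epsilon> + K)}"
      using acyl[unfolded acylindrical_along_def, rule_format, of "real (\<epsilon> + K)"] by auto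
    have comp: "action g (action h z) = action (g \<otimes> h) z" if "g \<in> carrier G" "h \<in> carrier G" for g h
      using iso that z group_action.composition_rule unfolding isometric_action_def by metis
    have close: "graph_dist X \<iota> (action g (action h z)) (action h z) \<le> real (\<epsilon> + K)"
      if "g \<in> carrier G" "h \<in> carrier G" "vertex_dist X (\<alpha> h x) (\<alpha> g (\<alpha> h x)) \<le> \<epsilon>" for g h
      using K[of "g \<otimes> h" h] that x vertex_dist_sym[of "\<alpha> h x" "\<alpha> g (\<alpha> h x)"]
      by (simp add: comp vert_mult)
    show "\<exists>R. \<forall>a\<in>H. R \<le> vertex_dist X x (\<alpha> a x) \<longrightarrow> finite {u \<in> carrier G.
        vertex_dist X x (\<alpha> u x) \<le> \<epsilon> \<and> vertex_dist X (\<alpha> a x) (\<alpha> u (\<alpha> a x)) \<le> \<epsilon>}"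
    proof (intro exI[of _ "nat \<lceil>R\<rceil> + K"] ballI impI)
      fix a assume a: "a \<in> H" "nat \<lceil>R\<rceil> + K \<le> vertex_dist X x (\<alpha> a x)"
      then have aG: "a \<in> carrier G" using HG by blast
      have "R \<le> graph_dist X \<iota> (action \<one> z) (action a z)"
        using K[of \<one> a] aG a(2) x by simp linarith
      then have "finite {g \<in> carrier G. graph_dist X \<iota> (action g (action \<one> z)) (action \<one> z) \<le> real (\<epsilon> + K) \<and>
          graph_dist X \<iota> (action g (action a z)) (action a z) \<le> real (\<epsilon> + K)}"
        using a one_H by (intro R) auto
      then show "finite {u \<in> carrier G.
          vertex_dist X x (\<alpha> u x) \<le> \<epsilon> \<and> vertex_dist X (\<alpha> a x) (\<alpha> u (\<alpha> a x)) \<le> \<epsilon>}"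
        by (rule rev_finite_subset) (use close[of _ \<one>] close[of _ a] aG x in auto)
    qed
  qed
  then show ?thesis by (rule that)
qed

end

section \<open>The cone-off\<close>

context connected_bidirected_graph begin

lemma arcs_ends_cone_off: "arcs_ends (cone_off X \<H>) = arcs_ends X \<union> cone_arcs X \<H>"
  by (auto simp: arcs_ends_def arc_to_ends_def cone_off_def image_Un image_image)

lemma cone_arcs_sym: "(u, v) \<in> cone_arcs X \<H> \<Longrightarrow> (v, u) \<in> cone_arcs X \<H>"
  by (auto simp: cone_arcs_def)

lemma connected_cone_off:
  "connected_bidirected_graph (cone_off X \<H>) (cone_off_rev X \<iota> \<H>)"
proof
  show "tail (cone_off X \<H>) e \<in> verts (cone_off X \<H>)" "head (cone_off X \<H>) e \<in> verts (cone_off X \<H>)"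
    if "e \<in> arcs (cone_off X \<H>)" for e
    using that by (auto simp: cone_off_def cone_arcs_def)
  \<comment> \<open>An added arc differs from its reversal because \<open>cone_arcs\<close> joins
    distinct vertices only.\<close>
  show "e \<in> arcs (cone_off X \<H>) \<longleftrightarrow> cone_off_rev X \<iota> \<H> e \<noteq> e" for e
    by (cases e) (auto simp: cone_off_def cone_off_rev_def arev_dom[symmetric] arev_neq arev_eq cone_arcs_def)
  show "cone_off_rev X \<iota> \<H> (cone_off_rev X \<iota> \<H> e) = e" for e
    by (cases e) (auto simp: cone_off_rev_def cone_arcs_sym)
  show "tail (cone_off X \<H>) (cone_off_rev X \<iota> \<H> e) = head (cone_off X \<H>) e"
    if "e \<in> arcs (cone_off X \<H>)" for e
    using that by (auto simp: cone_off_def cone_off_rev_def)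
  have "rtrancl_on (verts X) (arcs_ends X) \<subseteq> rtrancl_on (verts X) (arcs_ends (cone_off X \<H>))"
  proof clarify
    fix u v assume "(u, v) \<in> rtrancl_on (verts X) (arcs_ends X)"
    then show "(u, v) \<in> rtrancl_on (verts X) (arcs_ends (cone_off X \<H>))"
      by (induction rule: rtrancl_on_induct)
        (auto simp: arcs_ends_cone_off intro: rtrancl_on_into_rtrancl_on)
  qed
  then show "strongly_connected (cone_off X \<H>)"
    using connected by (auto simp: strongly_connected_def reachable_def cone_off_def)
qed

end

section \<open>The induced action on the cone-off\<close>

context graph_automorphisms begin

lemma cone_arcs_act:
  assumes inv: "\<And>g Y. g \<in> carrier G \<Longrightarrow> Y \<in> \<H> \<Longrightarrow> \<alpha> g ` Y \<in> \<H>"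
    and g: "g \<in> carrier G" and uv: "(u, v) \<in> cone_arcs X \<H>"
  shows "(\<alpha> g u, \<alpha> g v) \<in> cone_arcs X \<H>"
proof -
  obtain Y where Y: "Y \<in> \<H>" "u \<in> Y" "v \<in> Y" and V: "u \<in> verts X" "v \<in> verts X" "u \<noteq> v"
    using uv by (auto simp: cone_arcs_def)
  have "\<alpha> g u \<noteq> \<alpha> g v"
    using V g vertex_dist_act[OF g V(1,2)] vertex_dist_zero[OF V(1,2)]
      vertex_dist_zero[of "\<alpha> g u" "\<alpha> g v"] by simp
  moreover have "\<alpha> g u \<in> \<alpha> g ` Y" "\<alpha> g v \<in> \<alpha> g ` Y" using Y by blast+
  moreover have "\<alpha> g u \<in> verts X" "\<alpha> g v \<in> verts X" using V g by simp_all
  ultimately show ?thesis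
    unfolding cone_arcs_def mem_Collect_eq prod.case
    by (intro conjI bexI[OF _ inv[OF g Y(1)]])
qed

lemma graph_automorphisms_cone_off:
  assumes inv: "\<And>g Y. g \<in> carrier G \<Longrightarrow> Y \<in> \<H> \<Longrightarrow> \<alpha> g ` Y \<in> \<H>"
  shows "graph_automorphisms (cone_off X \<H>) (cone_off_rev X \<iota> \<H>) G \<alpha> (cone_off_arc_action X \<H> \<alpha> \<beta>)"
proof (intro graph_automorphisms.intro connected_cone_off is_group graph_automorphisms_axioms.intro)
  show "group_action G (verts (cone_off X \<H>)) \<alpha>"
    using verts_action by (simp add: cone_off_def)
next
  fix g e assume g: "g \<in> carrier G" and e: "e \<in> arcs (cone_off X \<H>)"
  have rev: "cone_off_rev X \<iota> \<H> e \<in> arcs (cone_off X \<H>)"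
    using e by (auto simp: cone_off_rev_def cone_off_def cone_arcs_sym)
  have act: "cone_off_arc_action X \<H> \<alpha> \<beta> g e' = map_sum (\<beta> g) (map_prod (\<alpha> g) (\<alpha> g)) e'"
    if "e' \<in> arcs (cone_off X \<H>)" for e'
    using that by (simp add: cone_off_arc_action_def)
  have cone: "(\<alpha> g u, \<alpha> g v) \<in> cone_arcs X \<H>" if "(u, v) \<in> cone_arcs X \<H>" for u v
    by (rule cone_arcs_act[OF inv g that])
  show "cone_off_arc_action X \<H> \<alpha> \<beta> g e \<in> arcs (cone_off X \<H>)"
    using e g arc_closed cone unfolding act[OF e] by (auto simp: cone_off_def)
  show "tail (cone_off X \<H>) (cone_off_arc_action X \<H> \<alpha> \<beta> g e) = \<alpha> g (tail (cone_off X \<H>) e)"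
    "head (cone_off X \<H>) (cone_off_arc_action X \<H> \<alpha> \<beta> g e) = \<alpha> g (head (cone_off X \<H>) e)"
    using e g unfolding act[OF e] by (auto simp: cone_off_def tail_act head_act)
  show "cone_off_arc_action X \<H> \<alpha> \<beta> g (cone_off_rev X \<iota> \<H> e) =
      cone_off_rev X \<iota> \<H> (cone_off_arc_action X \<H> \<alpha> \<beta> g e)"
    using e g cone unfolding act[OF e] act[OF rev]
    by (auto simp: cone_off_def cone_off_rev_def rev_act)
qed

lemma coset_orbits_memE:
  assumes "Y \<in> coset_orbits G \<alpha> H x" "H \<subseteq> carrier G" "x \<in> verts X"
  obtains k where "k \<in> carrier G" "Y = (\<lambda>h. \<alpha> k (\<alpha> h x)) ` H"
proof -
  obtain k where k: "k \<in> carrier G" "Y = (\<lambda>k. \<alpha> k x) ` (k <# H)"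
    using assms(1) by (auto simp: coset_orbits_def)
  have "Y = (\<lambda>h. \<alpha> k (\<alpha> h x)) ` H"
    unfolding k(2) l_coset_def using k(1) assms(2,3) by (force simp: vert_mult)
  then show ?thesis using k(1) that by blast
qed

lemma coset_orbits_memI:
  assumes "k \<in> carrier G" "H \<subseteq> carrier G" "x \<in> verts X"
  shows "(\<lambda>h. \<alpha> k (\<alpha> h x)) ` H \<in> coset_orbits G \<alpha> H x"
proof -
  have "(\<lambda>h. \<alpha> k (\<alpha> h x)) ` H = (\<lambda>k. \<alpha> k x) ` (k <# H)"
    unfolding l_coset_def using assms by (force simp: vert_mult)
  then show ?thesis using assms(1) by (auto simp: coset_orbits_def)
qed

lemma coset_orbits_invariant:
  assumes g: "g \<in> carrier G" and Y: "Y \<in> coset_orbits G \<alpha> H x"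
    and H: "H \<subseteq> carrier G" and x: "x \<in> verts X"
  shows "\<alpha> g ` Y \<in> coset_orbits G \<alpha> H x"
proof -
  obtain k where k: "k \<in> carrier G" "Y = (\<lambda>h. \<alpha> k (\<alpha> h x)) ` H"
    using coset_orbits_memE[OF Y H x] .
  have "\<alpha> g ` Y = (\<lambda>h. \<alpha> (g \<otimes> k) (\<alpha> h x)) ` H"
    unfolding k(2) image_image using g k(1) H x by (intro image_cong) (auto simp: vert_mult subset_iff)
  then show ?thesis using coset_orbits_memI[of "g \<otimes> k" H x] g k(1) H x by simp
qed

text \<open>\<open>k h k^-1\<close> carries \<open>k H x\<close> to \<open>k h H x\<close>, and
  \<open>h H = H\<close>.\<close>

lemma conjugate_stabilizes_coset_orbit:
  assumes H: "subgroup H G" and x: "x \<in> verts X" and k: "k \<in> carrier G" and h: "h \<in> H"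
    and f: "f = k \<otimes> h \<otimes> inv k"
  shows "\<alpha> f ` (\<lambda>h. \<alpha> k (\<alpha> h x)) ` H = (\<lambda>h. \<alpha> k (\<alpha> h x)) ` H"
proof -
  have HG: "H \<subseteq> carrier G" using H by (rule subgroup.subset)
  have "\<alpha> f (\<alpha> k (\<alpha> h' x)) = \<alpha> k (\<alpha> (h \<otimes> h') x)" if "h' \<in> H" for h'
  proof -
    have c: "h \<in> carrier G" "h' \<in> carrier G" using h that HG by auto
    then have "f \<otimes> (k \<otimes> h') = k \<otimes> (h \<otimes> h')"
      using k inv_solve_left[of h' k "k \<otimes> h'"] unfolding f by (simp add: m_assoc)
    then show ?thesis using k c x f by (metis inv_closed m_closed vert_closed vert_mult)
  qed
  then have "\<alpha> f ` (\<lambda>h. \<alpha> k (\<alpha> h x)) ` H = (\<lambda>h. \<alpha> k (\<alpha> h x)) ` (\<lambda>h'. h \<otimes> h') ` H"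
    unfolding image_image by (intro image_cong) auto
  also have "(\<lambda>h'. h \<otimes> h') ` H = H"
  proof (intro equalityI subsetI)
    fix h' assume "h' \<in> H"
    then have "inv h \<otimes> h' \<in> H" "h \<in> carrier G" "h' \<in> carrier G"
      using h H HG by (auto simp: subgroup.m_closed subgroup.m_inv_closed)
    moreover from this have "h' = h \<otimes> (inv h \<otimes> h')" by (simp flip: m_assoc)
    ultimately show "h' \<in> (\<lambda>h'. h \<otimes> h') ` H" by blast
  qed (use h H in \<open>auto simp: subgroup.m_closed\<close>)
  finally show ?thesis .
qed

end

section \<open>Comparison of the types of elements on the graph and on its cone-off\<close>

theorem corollary6p15:
  fixes G :: "('g, 'm) monoid_scheme"
    and X :: "('v, 'e) pre_digraph" and \<iota> :: "'e \<Rightarrow> 'e"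
    and \<alpha> :: "'g \<Rightarrow> 'v \<Rightarrow> 'v" and \<beta> :: "'g \<Rightarrow> 'e \<Rightarrow> 'e"
    and H :: "'g set" and x :: 'v
  defines "XR \<equiv> realization X \<iota>"
    and "dX \<equiv> graph_dist X \<iota>"
    and "actX \<equiv> realization_action X \<iota> \<alpha> \<beta>"
    and "\<H> \<equiv> coset_orbits G \<alpha> H x"
  defines "Xh \<equiv> cone_off X \<H>"
    and "revh \<equiv> cone_off_rev X \<iota> \<H>"
  defines "XhR \<equiv> realization Xh revh"
    and "dXh \<equiv> graph_dist Xh revh"
    and "actXh \<equiv> realization_action Xh revh \<alpha> (cone_off_arc_action X \<H> \<alpha> \<beta>)"
  assumes "connected_graph X \<iota>"
    and "graph_action G X \<iota> \<alpha> \<beta>"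
    and "AQI_triple G XR dX actX H"
    and "x \<in> verts X"
  shows "\<forall>g\<in>carrier G.
           (acts_loxodromically G XR dX actX g \<longrightarrow>
              acts_loxodromically G XhR dXh actXh g \<or>
              (\<exists>n::int. n \<noteq> 0 \<and> (\<exists>Y\<in>\<H>. \<alpha> (g [^]\<^bsub>G\<^esub> n) ` Y = Y)) \<and>
              acts_elliptically G XhR dXh actXh g) \<and>
           (acts_parabolically G XR dX actX g \<longleftrightarrow>
              acts_parabolically G XhR dXh actXh g)"
proof
  fix g assume g: "g \<in> carrier G"
  have x: "x \<in> verts X" by fact
  have AQI: "AQI_triple G (realization X \<iota>) (graph_dist X \<iota>) (realization_action X \<iota> \<alpha> \<beta>) H"
    using \<open>AQI_triple G XR dX actX H\<close> unfolding XR_def dX_def actX_def .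
  have sub: "subgroup H G" using AQI by (simp add: AQI_triple_def)
  then have HG: "H \<subseteq> carrier G" by (rule subgroup.subset)
  have verts_action: "group_action G (verts X) \<alpha>" and arcs_action: "group_action G (arcs X) \<beta>"
    and equivariant: "\<forall>g\<in>carrier G. \<forall>e\<in>arcs X. tail X (\<beta> g e) = \<alpha> g (tail X e) \<and>
      head X (\<beta> g e) = \<alpha> g (head X e) \<and> \<beta> g (\<iota> e) = \<iota> (\<beta> g e)"
    using \<open>graph_action G X \<iota> \<alpha> \<beta>\<close> by (auto simp: graph_action_def)
  have grp: "Group.group G"
    using verts_action unfolding group_action_def group_hom_def by blast
  have "connected_bidirected_graph X \<iota>"
    using \<open>connected_graph X \<iota>\<close>
    by (simp add: connected_graph_def connected_bidirected_graph_def connected_bidirected_graph_axioms_def)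
  then interpret B: graph_automorphisms X \<iota> G \<alpha> \<beta>
    by (intro graph_automorphisms.intro grp graph_automorphisms_axioms.intro)
      (use verts_action equivariant group_action.element_image[OF arcs_action] in auto)
  have "graph_automorphisms (cone_off X \<H>) (cone_off_rev X \<iota> \<H>) G \<alpha> (cone_off_arc_action X \<H> \<alpha> \<beta>)"
    unfolding \<H>_def by (rule B.graph_automorphisms_cone_off) (rule B.coset_orbits_invariant[OF _ _ HG x])
  then interpret C: graph_automorphisms Xh revh G \<alpha> "cone_off_arc_action X \<H> \<alpha> \<beta>"
    unfolding Xh_def revh_def .
  have verts_Xh [simp]: "verts Xh = verts X" by (simp add: Xh_def cone_off_def)
  have ends_Xh: "arcs_ends Xh = arcs_ends X \<union> cone_arcs X \<H>"
    unfolding Xh_def by (rule B.arcs_ends_cone_off)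
  have "gromov_hyperbolic (realization X \<iota>) (graph_dist X \<iota>)"
    using AQI by (simp add: AQI_triple_def hyperbolic_space_def)
  then obtain \<delta> where hyp: "hyperbolic_vertices (verts X) (vertex_dist X) \<delta>"
    by (rule B.hyperbolic_vertices_if_gromov_hyperbolic)
  obtain \<mu> A B where "coned_action (verts X) (vertex_dist X) \<delta> G \<alpha> H x \<mu> A B"
    using B.coned_action_if_AQI[OF AQI hyp x] .
  then interpret D: coned_action "verts X" "vertex_dist X" \<delta> G \<alpha> H x \<mu> A B .

  \<comment> \<open>From here on each type is a condition on the displacements of \<open>x\<close>
    alone, measured in \<open>X\<close> or in \<open>Xh\<close>.\<close>
  have ell: "acts_elliptically G XR dX actX f \<longleftrightarrow> (\<exists>B. \<forall>n::nat. vertex_dist X x (\<alpha> (f [^]\<^bsub>G\<^esub> n) x) \<le> B)"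
    and lox: "acts_loxodromically G XR dX actX f \<longleftrightarrow>
      (\<exists>c>0. \<exists>C. \<forall>n::nat. c * real n - C \<le> vertex_dist X x (\<alpha> (f [^]\<^bsub>G\<^esub> n) x))"
    and ellh: "acts_elliptically G XhR dXh actXh f \<longleftrightarrow> (\<exists>B. \<forall>n::nat. vertex_dist Xh x (\<alpha> (f [^]\<^bsub>G\<^esub> n) x) \<le> B)"
    and loxh: "acts_loxodromically G XhR dXh actXh f \<longleftrightarrow>
      (\<exists>c>0. \<exists>C. \<forall>n::nat. c * real n - C \<le> vertex_dist Xh x (\<alpha> (f [^]\<^bsub>G\<^esub> n) x))"
    if "f \<in> carrier G" for f
    unfolding XR_def dX_def actX_def XhR_def dXh_def actXh_def
    using B.acts_elliptically_iff[OF that x] B.acts_loxodromically_iff[OF that x]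
      C.acts_elliptically_iff[OF that, of x] C.acts_loxodromically_iff[OF that, of x] x by simp_all
  have dist_le: "vertex_dist Xh u v \<le> vertex_dist X u v" if "u \<in> verts X" "v \<in> verts X" for u v
    using that B.relpow_vertex_dist[OF that] relpow_mono_set[of "arcs_ends X" "arcs_ends Xh"] ends_Xh
    by (intro C.vertex_dist_le) auto

  \<comment> \<open>A shortest path in \<open>Xh\<close> thereby becomes a chain of cone steps of
    the same length.\<close>
  have "arcs_ends Xh \<subseteq> D.cone_step"
  proof (rule subrelI)
    fix u v assume "(u, v) \<in> arcs_ends Xh"
    then consider "(u, v) \<in> arcs_ends X" | "(u, v) \<in> cone_arcs X \<H>" unfolding ends_Xh by blast
    then show "(u, v) \<in> D.cone_step"
    proof cases
      case 1
      then have "u \<in> verts X" "v \<in> verts X" using B.adj_in_verts by auto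
      moreover have "vertex_dist X u v \<le> 1" using 1 \<open>u \<in> verts X\<close> by (intro B.vertex_dist_le) auto
      ultimately show ?thesis by (simp add: D.cone_step_def)
    next
      case 2
      then obtain Y where Y: "Y \<in> coset_orbits G \<alpha> H x" "u \<in> Y" "v \<in> Y"
        and V: "u \<in> verts X" "v \<in> verts X" by (auto simp: cone_arcs_def \<H>_def)
      obtain k where "k \<in> carrier G" "Y = (\<lambda>h. \<alpha> k (\<alpha> h x)) ` H"
        using B.coset_orbits_memE[OF Y(1) HG x] .
      then show ?thesis using Y V unfolding D.cone_step_def by blast
    qed
  qed
  then have step: "(x, \<alpha> (g [^]\<^bsub>G\<^esub> (n::nat)) x) \<in> D.cone_step ^^ vertex_dist Xh x (\<alpha> (g [^]\<^bsub>G\<^esub> n) x)" for n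
    by (rule subsetD[OF relpow_mono_set]) (use C.relpow_vertex_dist[of x] g x in simp)

  have loxodromic: "(\<exists>n::int. n \<noteq> 0 \<and> (\<exists>Y\<in>\<H>. \<alpha> (g [^]\<^bsub>G\<^esub> n) ` Y = Y)) \<and>
      acts_elliptically G XhR dXh actXh g"
    if L: "acts_loxodromically G XR dX actX g" and NL: "\<not> acts_loxodromically G XhR dXh actXh g"
  proof -
    obtain c C where c: "c > 0" and C: "\<And>n::nat. c * real n - C \<le> vertex_dist X x (\<alpha> (g [^]\<^bsub>G\<^esub> n) x)"
      using L unfolding lox[OF g] by blast
    have "\<exists>(n::nat) m. (x, \<alpha> (g [^]\<^bsub>G\<^esub> n) x) \<in> D.cone_step ^^ m \<and>
        K * m < vertex_dist X x (\<alpha> (g [^]\<^bsub>G\<^esub> n) x)" for K :: nat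
    proof -
      \<comment> \<open>Failure of loxodromicity on \<open>Xh\<close> is used with slope
        \<open>c / K'\<close> and constant \<open>C / K'\<close>, so that multiplication by
        \<open>K'\<close> meets the lower bound in \<open>X\<close>. The summand \<open>1\<close>
        keeps \<open>K'\<close> positive for \<open>K = 0\<close>.\<close>
      define K' where "K' = real K + 1"
      have K': "K' > 0" by (simp add: K'_def)
      then have "c / K' > 0" using c by simp
      then obtain n :: nat where n: "vertex_dist Xh x (\<alpha> (g [^]\<^bsub>G\<^esub> n) x) < c / K' * real n - C / K'"
        using NL unfolding loxh[OF g] by (metis not_less)
      define m where "m = vertex_dist Xh x (\<alpha> (g [^]\<^bsub>G\<^esub> n) x)"
      have "real m < (c * real n - C) / K'" using n unfolding m_def[symmetric] by (simp add: diff_divide_distrib)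
      then have "real m * K' < c * real n - C" using K' by (simp add: pos_less_divide_eq)
      moreover have "real m * K' \<ge> real (K * m)" by (simp add: K'_def algebra_simps)
      ultimately have "real (K * m) < real (vertex_dist X x (\<alpha> (g [^]\<^bsub>G\<^esub> n) x))" using C[of n] by linarith
      then show ?thesis using step[of n] unfolding m_def by (metis of_nat_less_iff)
    qed
    then obtain m k h where m: "0 < m" and k: "k \<in> carrier G" and h: "h \<in> H"
      and eq: "g [^]\<^bsub>G\<^esub> (m::nat) = k \<otimes>\<^bsub>G\<^esub> h \<otimes>\<^bsub>G\<^esub> inv\<^bsub>G\<^esub> k"
      using D.power_in_conjugate[OF g] by blast
    define Y where "Y = (\<lambda>h. \<alpha> k (\<alpha> h x)) ` H"
    have Y: "Y \<in> \<H>" unfolding Y_def \<H>_def by (rule B.coset_orbits_memI[OF k HG x])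
    have stab: "\<alpha> (g [^]\<^bsub>G\<^esub> m) ` Y = Y"
      unfolding Y_def by (rule B.conjugate_stabilizes_coset_orbit[OF sub x k h eq])
    define y where "y = \<alpha> k (\<alpha> \<one>\<^bsub>G\<^esub> x)"
    have y: "y \<in> Y" "y \<in> verts X"
      using image_eqI[OF refl subgroup.one_closed[OF sub], of "\<lambda>h. \<alpha> k (\<alpha> h x)"] k x
      unfolding Y_def y_def by (blast, simp)
    have "acts_elliptically G XhR dXh actXh g"
      unfolding XhR_def dXh_def actXh_def
    proof (rule C.acts_elliptically_if_power_bounded[OF g _ m])
      fix q :: nat
      define f where "f = (g [^]\<^bsub>G\<^esub> m) [^]\<^bsub>G\<^esub> q"
      have f: "f \<in> carrier G" using g by (simp add: f_def)
      have "\<alpha> ((g [^]\<^bsub>G\<^esub> m) [^]\<^bsub>G\<^esub> q) y \<in> Y"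
      proof (induction q)
        case (Suc q)
        have "(g [^]\<^bsub>G\<^esub> m) [^]\<^bsub>G\<^esub> Suc q = g [^]\<^bsub>G\<^esub> m \<otimes>\<^bsub>G\<^esub> (g [^]\<^bsub>G\<^esub> m) [^]\<^bsub>G\<^esub> q"
          by (rule B.nat_pow_Suc2) (use g in simp)
        then show ?case using Suc stab y g by (auto simp: B.vert_mult)
      qed (use y in simp)
      \<comment> \<open>Powers of \<open>g^m\<close> keep \<open>y\<close> in \<open>Y\<close>,
        whose distinct points are joined by a single added edge.\<close>
      then have "\<alpha> f y = y \<or> (y, \<alpha> f y) \<in> arcs_ends Xh"
        using y f Y unfolding f_def[symmetric] ends_Xh cone_arcs_def by auto
      then show "vertex_dist Xh y (\<alpha> ((g [^]\<^bsub>G\<^esub> m) [^]\<^bsub>G\<^esub> q) y) \<le> 1"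
        unfolding f_def[symmetric] using y C.vertex_dist_zero[of y y] C.vertex_dist_le[of y "\<alpha> f y" 1] by auto
    qed (use y in simp)
    then show ?thesis
      using m Y stab by (intro conjI exI[of _ "int m"] bexI[of _ Y]) (simp_all add: int_pow_int)
  qed

  have not_parabolic: "acts_loxodromically G XR dX actX g"
    if E: "acts_elliptically G XhR dXh actXh g" and NE: "\<not> acts_elliptically G XR dX actX g"
  proof (rule ccontr)
    assume NL: "\<not> ?thesis"
    obtain B where B: "\<And>n::nat. vertex_dist Xh x (\<alpha> (g [^]\<^bsub>G\<^esub> n) x) \<le> B"
      using E unfolding ellh[OF g] by blast
    have short: "\<exists>(n::nat) m. (x, \<alpha> (g [^]\<^bsub>G\<^esub> n) x) \<in> D.cone_step ^^ m \<and>
        K * m < vertex_dist X x (\<alpha> (g [^]\<^bsub>G\<^esub> n) x)" for K :: nat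
    proof -
      \<comment> \<open>All powers cost at most \<open>B\<close> steps in \<open>Xh\<close>, while
        the displacements in \<open>X\<close> are unbounded.\<close>
      obtain n :: nat where "K * B < vertex_dist X x (\<alpha> (g [^]\<^bsub>G\<^esub> n) x)"
        using NE unfolding ell[OF g] by (metis not_less)
      moreover have "K * vertex_dist Xh x (\<alpha> (g [^]\<^bsub>G\<^esub> n) x) \<le> K * B" using B by simp
      ultimately show ?thesis using step[of n] by (meson le_less_trans)
    qed
    obtain m :: nat where m: "0 < m" "g [^]\<^bsub>G\<^esub> m = \<one>\<^bsub>G\<^esub>"
      using D.torsion_if_no_drift[OF g short] B.no_drift_if_not_loxodromic[OF hyp g]
        NL[unfolded XR_def dX_def actX_def] by blast
    have "acts_elliptically G XR dX actX g"
      unfolding XR_def dX_def actX_def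
      by (rule B.acts_elliptically_if_power_bounded[OF g x m(1), of 0])
        (use m(2) x B.vertex_dist_zero[of x x] in simp)
    then show False using NE by contradiction
  qed

  have "acts_elliptically G XhR dXh actXh g" if "acts_elliptically G XR dX actX g"
    using that dist_le[OF x] g x unfolding ell[OF g] ellh[OF g]
    by (meson B.nat_pow_closed B.vert_closed le_trans)
  moreover have "acts_loxodromically G XR dX actX g" if "acts_loxodromically G XhR dXh actXh g"
  proof -
    have "real (vertex_dist Xh x (\<alpha> (g [^]\<^bsub>G\<^esub> n) x)) \<le> real (vertex_dist X x (\<alpha> (g [^]\<^bsub>G\<^esub> n) x))" for n :: nat
      using dist_le[OF x, of "\<alpha> (g [^]\<^bsub>G\<^esub> n) x"] g x by simp
    then show ?thesis using that unfolding lox[OF g] loxh[OF g] by (meson order_trans)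
  qed
  \<comment> \<open>Elliptic passes from \<open>X\<close> to \<open>Xh\<close>, loxodromic from
    \<open>Xh\<close> to \<open>X\<close>. So an element parabolic on \<open>X\<close> could only
    become elliptic, which \<open>not_parabolic\<close> forbids; one parabolic on \<open>Xh\<close>
    cannot be loxodromic on \<open>X\<close>, since by \<open>loxodromic\<close> it would be
    elliptic on \<open>Xh\<close>.\<close>
  ultimately show "(acts_loxodromically G XR dX actX g \<longrightarrow>
      acts_loxodromically G XhR dXh actXh g \<or>
      (\<exists>n::int. n \<noteq> 0 \<and> (\<exists>Y\<in>\<H>. \<alpha> (g [^]\<^bsub>G\<^esub> n) ` Y = Y)) \<and>
      acts_elliptically G XhR dXh actXh g) \<and>
    (acts_parabolically G XR dX actX g \<longleftrightarrow> acts_parabolically G XhR dXh actXh g)"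
    using loxodromic not_parabolic unfolding acts_parabolically_def by blast
qed

end
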